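(* Let $q\in\mathbb{C}^*$ not be a root of unity and $n\ge1$. Then the natural map $\mathrm{Aut}(A_q^n)/\mathrm{Inn}(A_q^n)\to\mathrm{Pic}(A_q^n)$, sending $\psi$ to the bimodule $(A_q^n)_\psi$, is an isomorphism.
   Context: $A_q$ is the $\mathbb{C}$-algebra generated by $x^{\pm1},y^{\pm1}$ with $xy=qyx$; $A_q^n=A_q^{\otimes n}$ (tensor product over $\mathbb{C}$). $\mathrm{Inn}$ denotes inner automorphisms; $\mathrm{Pic}$ is the group of invertible bimodules; for $\psi\in\mathrm{Aut}(A)$, $A_\psi$ is $A$ with usual left action and right action twisted by $\psi$. *)

theory Defs
  imports Complex_Main "HOL-Library.Poly_Mapping" "HOL-Library.Function_Algebras"
begin

text \<open>Exponent vectors: e :: nat =>0 int. Index 2k is the exponent of x_k, index 2k+1 the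
exponent of y_k (generators of the k-th tensor factor A_q). An element of A_q^n is a finite
C-linear combination of normally ordered monomials x_0^e0 y_0^e1 x_1^e2 y_1^e3 ... with
exponent vectors supported in {..<2n}.\<close>

type_synonym qexp = "nat \<Rightarrow>\<^sub>0 int"
type_synonym qelem = "qexp \<Rightarrow>\<^sub>0 complex"

definition qsig :: "qexp \<Rightarrow> qexp \<Rightarrow> int" where
  "qsig a c = (\<Sum>k\<in>{k. Suc (2*k) \<in> Poly_Mapping.keys a}. Poly_Mapping.lookup a (Suc (2*k)) * Poly_Mapping.lookup c (2*k))"

text \<open>m(a) m(c) = q^(-qsig a c) m(a+c); this encodes x_k y_k = q y_k x_k and that
generators of different factors commute.\<close>
definition qmult :: "complex \<Rightarrow> qelem \<Rightarrow> qelem \<Rightarrow> qelem" where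
  "qmult q f g = (\<Sum>a\<in>Poly_Mapping.keys f. \<Sum>c\<in>Poly_Mapping.keys g.
      Poly_Mapping.single (a + c) (Poly_Mapping.lookup f a * Poly_Mapping.lookup g c * q powi (- qsig a c)))"

definition QT :: "nat \<Rightarrow> qelem set" where
  "QT n = {f. \<forall>e\<in>Poly_Mapping.keys f. Poly_Mapping.keys e \<subseteq> {..<2*n}}"

definition qscalar :: "complex \<Rightarrow> qelem" where
  "qscalar c = Poly_Mapping.single 0 c"

abbreviation qone :: qelem where "qone \<equiv> qscalar 1"

definition qaut :: "complex \<Rightarrow> nat \<Rightarrow> (qelem \<Rightarrow> qelem) \<Rightarrow> bool" where
  "qaut q n \<psi> \<longleftrightarrow> bij_betw \<psi> (QT n) (QT n) \<and>
     (\<forall>a\<in>QT n. \<forall>b\<in>QT n. \<psi> (a + b) = \<psi> a + \<psi> b \<and> \<psi> (qmult q a b) = qmult q (\<psi> a) (\<psi> b)) \<and>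
     (\<forall>c. \<forall>a\<in>QT n. \<psi> (qmult q (qscalar c) a) = qmult q (qscalar c) (\<psi> a)) \<and>
     \<psi> qone = qone"

definition qinner :: "complex \<Rightarrow> nat \<Rightarrow> (qelem \<Rightarrow> qelem) \<Rightarrow> bool" where
  "qinner q n \<chi> \<longleftrightarrow> (\<exists>u\<in>QT n. \<exists>v\<in>QT n. qmult q u v = qone \<and> qmult q v u = qone \<and>
     (\<forall>a\<in>QT n. \<chi> a = qmult q (qmult q u a) v))"

record 'm bimod =
  carr :: "'m set"
  addb :: "'m \<Rightarrow> 'm \<Rightarrow> 'm"
  zerob :: 'm
  negb :: "'m \<Rightarrow> 'm"
  lact :: "qelem \<Rightarrow> 'm \<Rightarrow> 'm"
  ract :: "'m \<Rightarrow> qelem \<Rightarrow> 'm"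

definition is_bimod :: "complex \<Rightarrow> nat \<Rightarrow> 'm bimod \<Rightarrow> bool" where
  "is_bimod q n M \<longleftrightarrow>
     zerob M \<in> carr M \<and>
     (\<forall>x\<in>carr M. \<forall>y\<in>carr M. addb M x y \<in> carr M) \<and>
     (\<forall>x\<in>carr M. negb M x \<in> carr M) \<and>
     (\<forall>x\<in>carr M. \<forall>y\<in>carr M. \<forall>z\<in>carr M. addb M (addb M x y) z = addb M x (addb M y z)) \<and>
     (\<forall>x\<in>carr M. \<forall>y\<in>carr M. addb M x y = addb M y x) \<and>
     (\<forall>x\<in>carr M. addb M (zerob M) x = x) \<and>
     (\<forall>x\<in>carr M. addb M (negb M x) x = zerob M) \<and>
     (\<forall>a\<in>QT n. \<forall>x\<in>carr M. lact M a x \<in> carr M \<and> ract M x a \<in> carr M) \<and>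
     (\<forall>a\<in>QT n. \<forall>x\<in>carr M. \<forall>y\<in>carr M.
        lact M a (addb M x y) = addb M (lact M a x) (lact M a y) \<and>
        ract M (addb M x y) a = addb M (ract M x a) (ract M y a)) \<and>
     (\<forall>a\<in>QT n. \<forall>b\<in>QT n. \<forall>x\<in>carr M.
        lact M (a + b) x = addb M (lact M a x) (lact M b x) \<and>
        ract M x (a + b) = addb M (ract M x a) (ract M x b) \<and>
        lact M (qmult q a b) x = lact M a (lact M b x) \<and>
        ract M x (qmult q a b) = ract M (ract M x a) b \<and>
        ract M (lact M a x) b = lact M a (ract M x b)) \<and>
     (\<forall>x\<in>carr M. lact M qone x = x \<and> ract M x qone = x) \<and>
     (\<forall>c. \<forall>x\<in>carr M. lact M (qscalar c) x = ract M x (qscalar c))"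

definition bimod_iso :: "complex \<Rightarrow> nat \<Rightarrow> 'm bimod \<Rightarrow> 'p bimod \<Rightarrow> bool" where
  "bimod_iso q n M P \<longleftrightarrow> (\<exists>f. bij_betw f (carr M) (carr P) \<and>
     (\<forall>x\<in>carr M. \<forall>y\<in>carr M. f (addb M x y) = addb P (f x) (f y)) \<and>
     (\<forall>a\<in>QT n. \<forall>x\<in>carr M. f (lact M a x) = lact P a (f x) \<and> f (ract M x a) = ract P (f x) a))"

definition twisted :: "complex \<Rightarrow> nat \<Rightarrow> (qelem \<Rightarrow> qelem) \<Rightarrow> qelem bimod" where
  "twisted q n \<psi> = \<lparr>carr = QT n, addb = (+), zerob = 0, negb = uminus,
                     lact = qmult q, ract = (\<lambda>x a. qmult q x (\<psi> a))\<rparr>"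

text \<open>Elements of the free abelian group on M x N are represented by signed words; the
content of a word is its image in the free abelian group (finitely supported integer
functions on M x N).\<close>

definition delta :: "'a \<Rightarrow> 'a \<Rightarrow> int" where
  "delta p = (\<lambda>z. if z = p then 1 else 0)"

fun content :: "(('a \<times> 'b) \<times> bool) list \<Rightarrow> ('a \<times> 'b) \<Rightarrow> int" where
  "content [] = 0"
| "content ((p, s) # w) = (if s then delta p else - delta p) + content w"

definition tensor_gens :: "nat \<Rightarrow> 'a bimod \<Rightarrow> 'b bimod \<Rightarrow> (('a \<times> 'b) \<Rightarrow> int) set" where
  "tensor_gens n M N =
     {delta (addb M x x', y) - delta (x, y) - delta (x', y)
       | x x' y. x \<in> carr M \<and> x' \<in> carr M \<and> y \<in> carr N}
   \<union> {delta (x, addb N y y') - delta (x, y) - delta (x, y')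
       | x y y'. x \<in> carr M \<and> y \<in> carr N \<and> y' \<in> carr N}
   \<union> {delta (ract M x a, y) - delta (x, lact N a y)
       | x a y. x \<in> carr M \<and> a \<in> QT n \<and> y \<in> carr N}"

inductive_set tensor_rel :: "nat \<Rightarrow> 'a bimod \<Rightarrow> 'b bimod \<Rightarrow> (('a \<times> 'b) \<Rightarrow> int) set"
  for n M N where
  zero: "0 \<in> tensor_rel n M N"
| add: "r \<in> tensor_rel n M N \<Longrightarrow> g \<in> tensor_gens n M N \<Longrightarrow> r + g \<in> tensor_rel n M N"
| sub: "r \<in> tensor_rel n M N \<Longrightarrow> g \<in> tensor_gens n M N \<Longrightarrow> r - g \<in> tensor_rel n M N"

fun word_eval :: "'p bimod \<Rightarrow> ('a \<Rightarrow> 'b \<Rightarrow> 'p) \<Rightarrow> (('a \<times> 'b) \<times> bool) list \<Rightarrow> 'p" where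
  "word_eval P \<beta> [] = zerob P"
| "word_eval P \<beta> (((x, y), s) # w) =
     addb P (if s then \<beta> x y else negb P (\<beta> x y)) (word_eval P \<beta> w)"

definition balanced_bimap :: "complex \<Rightarrow> nat \<Rightarrow> 'a bimod \<Rightarrow> 'b bimod \<Rightarrow> 'p bimod \<Rightarrow> ('a \<Rightarrow> 'b \<Rightarrow> 'p) \<Rightarrow> bool" where
  "balanced_bimap q n M N P \<beta> \<longleftrightarrow>
     (\<forall>x\<in>carr M. \<forall>y\<in>carr N. \<beta> x y \<in> carr P) \<and>
     (\<forall>x\<in>carr M. \<forall>x'\<in>carr M. \<forall>y\<in>carr N. \<beta> (addb M x x') y = addb P (\<beta> x y) (\<beta> x' y)) \<and>
     (\<forall>x\<in>carr M. \<forall>y\<in>carr N. \<forall>y'\<in>carr N. \<beta> x (addb N y y') = addb P (\<beta> x y) (\<beta> x y')) \<and>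
     (\<forall>a\<in>QT n. \<forall>x\<in>carr M. \<forall>y\<in>carr N.
        \<beta> (ract M x a) y = \<beta> x (lact N a y) \<and>
        \<beta> (lact M a x) y = lact P a (\<beta> x y) \<and>
        \<beta> x (ract N y a) = ract P (\<beta> x y) a)"

text \<open>tensor_iso q n M N P: there is an isomorphism of bimodules M \<otimes>_A N \<cong> P, i.e. a
balanced bimodule map beta : M x N \<rightarrow> P whose induced map on M \<otimes>_A N = (free abelian
group on M x N)/(relations) is bijective.\<close>
definition tensor_iso :: "complex \<Rightarrow> nat \<Rightarrow> 'a bimod \<Rightarrow> 'b bimod \<Rightarrow> 'p bimod \<Rightarrow> bool" where
  "tensor_iso q n M N P \<longleftrightarrow> (\<exists>\<beta>. balanced_bimap q n M N P \<beta> \<and>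
     (\<forall>v\<in>carr P. \<exists>w. (\<forall>((x, y), s)\<in>set w. x \<in> carr M \<and> y \<in> carr N) \<and> word_eval P \<beta> w = v) \<and>
     (\<forall>w. (\<forall>((x, y), s)\<in>set w. x \<in> carr M \<and> y \<in> carr N) \<and> word_eval P \<beta> w = zerob P
          \<longrightarrow> content w \<in> tensor_rel n M N))"

definition invertible_bimod :: "complex \<Rightarrow> nat \<Rightarrow> 'm bimod \<Rightarrow> 'n bimod \<Rightarrow> bool" where
  "invertible_bimod q n M N \<longleftrightarrow> is_bimod q n M \<and> is_bimod q n N \<and>
     tensor_iso q n M N (twisted q n id) \<and> tensor_iso q n N M (twisted q n id)"

end

theory Submission
  imports Defs "HOL-Combinatorics.Transposition" "HOL-Library.FuncSet"
begin

text \<open>The hard part is that every invertible bimodule \<open>M\<close> is free of rank one as a left module.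
  A pairing with a fixed element of the inverse bimodule embeds \<open>M\<close> into the algebra as a left ideal
  \<open>I\<close>, on which right multiplication by a monomial acts as a left-linear automorphism \<open>R\<close>. By
  the Ore condition, the change of leading exponent \<open>x \<mapsto> R x\<close>, for any monomial order, does not
  depend on \<open>x\<close>; since all powers of \<open>R\<close> act, the Newton polytope of \<open>R x\<close> is the one of \<open>x\<close>
  translated by a fixed vector \<open>S\<close>. Therefore \<open>x \<mapsto> m(-S) (R x)\<close> preserves the finite-dimensional space of
  elements of \<open>I\<close> supported in a given box, and an element of that space with minimal leading exponent is
  an eigenvector. It is an eigenvector for all monomials at once: some \<open>x0\<close> in \<open>M\<close> satisfies
  \<open>x0 a = \<psi>(a) x0\<close>. As the algebra is simple, \<open>x0\<close> generates \<open>M\<close>, and Morita theory shows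
  that \<open>\<psi>\<close> is an automorphism.\<close>

section \<open>The quantum torus as a domain\<close>

text \<open>The left module structure of the ideal alone yields no evident generator; the right
  action has to supply it. Monomials are units, so they act by automorphisms, and they span the
  algebra, so an eigenvector common to all of them is an eigenvector for every algebra element. Of
  the Newton polytope only the bounding box enters. The maximum and minimum of the i-th coordinate
  over a support are read off from the orders that put this coordinate, or its negative, in front,
  and in each such order only the front coordinate of the change of leading exponent is compared
  with S. That q is not a root of unity enters through simplicity: monomials with different
  exponents must be distinguished by how they commute with the generators. The isomorphisms of the
  two tensor products with the algebra are independent of each other and need not form a Morita
  context. Each is used through its universal property: an expression in x and y that respects the
  tensor relations depends only on \<beta>(x,y). Nondegeneracy, absence of torsion and the
  description of left endomorphisms are all obtained by finding the right expression.\<close>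

lemma finite_odd_keys: "finite {k. Suc (2*k) \<in> Poly_Mapping.keys (a :: qexp)}"
proof (rule finite_subset)
  show "{k. Suc (2*k) \<in> Poly_Mapping.keys a} \<subseteq> (\<lambda>i. i div 2) ` Poly_Mapping.keys a"
    by force
qed simp

lemma qsig_superset:
  assumes "finite K" "{k. Suc (2*k) \<in> Poly_Mapping.keys a} \<subseteq> K"
  shows "qsig a c = (\<Sum>k\<in>K. Poly_Mapping.lookup a (Suc (2*k)) * Poly_Mapping.lookup c (2*k))"
  unfolding qsig_def
  by (rule sum.mono_neutral_left) (use assms in \<open>auto simp: in_keys_iff\<close>)

lemma qsig_add_left: "qsig (a + b) c = qsig a c + qsig b c"
proof -
  let ?K = "{k. Suc (2*k) \<in> Poly_Mapping.keys a} \<union> {k. Suc (2*k) \<in> Poly_Mapping.keys b}"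
  have fin: "finite ?K" by (simp add: finite_odd_keys)
  have "{k. Suc (2*k) \<in> Poly_Mapping.keys (a + b)} \<subseteq> ?K"
    using keys_add[of a b] by auto
  then show ?thesis
    using fin by (simp add: qsig_superset[of ?K] lookup_add distrib_right sum.distrib)
qed

lemma qsig_add_right: "qsig a (b + c) = qsig a b + qsig a c"
  by (simp add: qsig_def lookup_add distrib_left sum.distrib)

lemma qsig_zero [simp]: "qsig 0 c = 0" "qsig a 0 = 0"
  by (simp_all add: qsig_def)

text \<open>Pairing with a generator reads off the exponent of its partner in the same tensor
  factor. These four evaluations determine how a monomial commutes with x_k and y_k.\<close>

lemma qsig_single_odd_left: "qsig (Poly_Mapping.single (Suc (2*k)) 1) c = Poly_Mapping.lookup c (2*k)"
  by (subst qsig_superset[of "{k}"]) auto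

lemma qsig_single_odd_right: "qsig a (Poly_Mapping.single (Suc (2*k)) 1) = 0"
  unfolding qsig_def lookup_single by (rule sum.neutral) (auto simp: when_def, presburger)

lemma qsig_single_even_left: "qsig (Poly_Mapping.single (2*k) 1) c = 0"
proof -
  have "{j. Suc (2*j) \<in> Poly_Mapping.keys (Poly_Mapping.single (2*k) (1::int))} = {}"
    by (auto, presburger)
  then show ?thesis by (simp add: qsig_def)
qed

lemma qsig_single_even_right: "qsig a (Poly_Mapping.single (2*k) 1) = Poly_Mapping.lookup a (Suc (2*k))"
  by (subst qsig_superset[of "insert k {k. Suc (2*k) \<in> Poly_Mapping.keys a}"])
     (auto simp: finite_odd_keys lookup_single when_def if_distrib sum.delta cong: if_cong)

definition qexps :: "nat \<Rightarrow> qexp set" where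
  "qexps n = {e. Poly_Mapping.keys e \<subseteq> {..<2*n}}"

lemma qexps_iff: "e \<in> qexps n \<longleftrightarrow> (\<forall>i\<ge>2*n. Poly_Mapping.lookup e i = 0)"
  by (auto simp: qexps_def in_keys_iff) (meson not_le)

lemma qexps_add: "a \<in> qexps n \<Longrightarrow> b \<in> qexps n \<Longrightarrow> a + b \<in> qexps n"
  by (simp add: qexps_iff lookup_add)
lemma qexps_diff: "a \<in> qexps n \<Longrightarrow> b \<in> qexps n \<Longrightarrow> a - b \<in> qexps n"
  by (simp add: qexps_iff lookup_minus)
lemma qexps_uminus: "a \<in> qexps n \<Longrightarrow> - a \<in> qexps n"
  by (simp add: qexps_iff)
lemma qexps_zero [simp]: "0 \<in> qexps n"
  by (simp add: qexps_iff)
lemma qexps_single: "i < 2*n \<Longrightarrow> Poly_Mapping.single i k \<in> qexps n"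
  by (auto simp: qexps_iff lookup_single when_def)

lemma QT_iff: "f \<in> QT n \<longleftrightarrow> Poly_Mapping.keys f \<subseteq> qexps n"
  by (auto simp: QT_def qexps_def)

lemma QT_zero [simp]: "0 \<in> QT n"
  by (simp add: QT_iff)
lemma QT_add: "f \<in> QT n \<Longrightarrow> g \<in> QT n \<Longrightarrow> f + g \<in> QT n"
  using keys_add[of f g] by (auto simp: QT_iff)
lemma QT_uminus: "f \<in> QT n \<Longrightarrow> - f \<in> QT n"
  by (auto simp: QT_iff in_keys_iff)
lemma QT_diff: "f \<in> QT n \<Longrightarrow> g \<in> QT n \<Longrightarrow> f - g \<in> QT n"
  using QT_add[of f n "- g"] QT_uminus[of g n] by simp
lemma QT_single: "e \<in> qexps n \<Longrightarrow> Poly_Mapping.single e c \<in> QT n"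
  by (simp add: QT_iff)
lemma QT_sum: "(\<And>i. i \<in> X \<Longrightarrow> f i \<in> QT n) \<Longrightarrow> sum f X \<in> QT n"
  by (induction X rule: infinite_finite_induct) (auto intro: QT_add)
lemma QT_qscalar [simp]: "qscalar c \<in> QT n"
  by (simp add: qscalar_def QT_single)

text \<open>The membership of e in the support of f is kept in the single case, so that an induction
  over an element of \<open>QT n\<close> meets only monomials of \<open>QT n\<close>.\<close>

lemma qelem_induct [case_names zero single add]:
  fixes f :: qelem
  assumes "P 0" "\<And>e c. e \<in> Poly_Mapping.keys f \<Longrightarrow> P (Poly_Mapping.single e c)"
    and "\<And>g h. P g \<Longrightarrow> P h \<Longrightarrow> P (g + h)"
  shows "P f"
proof -
  have "P (\<Sum>e\<in>X. Poly_Mapping.single e (Poly_Mapping.lookup f e))" if "X \<subseteq> Poly_Mapping.keys f" for X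
    using finite_subset[OF that finite_keys] that by (induction X rule: finite_induct) (auto intro: assms)
  moreover have "f = (\<Sum>e\<in>Poly_Mapping.keys f. Poly_Mapping.single e (Poly_Mapping.lookup f e))"
    by (rule poly_mapping_eqI) (simp add: lookup_sum lookup_single when_def sum.delta in_keys_iff)
  ultimately show ?thesis by (metis subset_refl)
qed

lemma qmult_superset:
  assumes "finite F" "finite G" "Poly_Mapping.keys f \<subseteq> F" "Poly_Mapping.keys g \<subseteq> G"
  shows "qmult q f g = (\<Sum>a\<in>F. \<Sum>c\<in>G.
      Poly_Mapping.single (a + c) (Poly_Mapping.lookup f a * Poly_Mapping.lookup g c * q powi (- qsig a c)))"
proof -
  have "qmult q f g = (\<Sum>a\<in>Poly_Mapping.keys f. \<Sum>c\<in>G.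
      Poly_Mapping.single (a + c) (Poly_Mapping.lookup f a * Poly_Mapping.lookup g c * q powi (- qsig a c)))"
    unfolding qmult_def using assms
    by (intro sum.cong sum.mono_neutral_left refl) (auto simp: in_keys_iff)
  also have "\<dots> = (\<Sum>a\<in>F. \<Sum>c\<in>G.
      Poly_Mapping.single (a + c) (Poly_Mapping.lookup f a * Poly_Mapping.lookup g c * q powi (- qsig a c)))"
    using assms by (intro sum.mono_neutral_left) (auto simp: in_keys_iff)
  finally show ?thesis .
qed

lemma qmult_add_left: "qmult q (f + g) h = qmult q f h + qmult q g h"
proof -
  let ?F = "Poly_Mapping.keys f \<union> Poly_Mapping.keys g"
  have "Poly_Mapping.keys (f + g) \<subseteq> ?F" by (rule keys_add)
  then show ?thesis
    by (simp add: qmult_superset[of ?F "Poly_Mapping.keys h"] lookup_add distrib_right single_add sum.distrib)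
qed

lemma qmult_add_right: "qmult q h (f + g) = qmult q h f + qmult q h g"
proof -
  let ?F = "Poly_Mapping.keys f \<union> Poly_Mapping.keys g"
  have "Poly_Mapping.keys (f + g) \<subseteq> ?F" by (rule keys_add)
  then show ?thesis
    by (simp add: qmult_superset[of "Poly_Mapping.keys h" ?F] lookup_add distrib_right distrib_left single_add sum.distrib)
qed

lemma qmult_zero [simp]: "qmult q 0 f = 0" "qmult q f 0 = 0"
  by (simp_all add: qmult_def)

lemma qmult_uminus_left: "qmult q (- f) g = - qmult q f g"
  using qmult_add_left[of q f "- f" g] by (simp add: eq_neg_iff_add_eq_0 add.commute)
lemma qmult_uminus_right: "qmult q f (- g) = - qmult q f g"
  using qmult_add_right[of q f g "- g"] by (simp add: eq_neg_iff_add_eq_0 add.commute)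

lemma qmult_single_single:
  "qmult q (Poly_Mapping.single a u) (Poly_Mapping.single c v) = Poly_Mapping.single (a + c) (u * v * q powi (- qsig a c))"
  by (subst qmult_superset[of "{a}" "{c}"]) auto

lemma qmult_sum_left: "qmult q (sum f X) g = (\<Sum>i\<in>X. qmult q (f i) g)"
  by (induction X rule: infinite_finite_induct) (auto simp: qmult_add_left)

text \<open>Since \<open>qsig\<close> is biadditive and q is invertible, q^(-qsig) is a bicharacter,
  hence a 2-cocycle on exponents; this is associativity for monomials, and biadditivity of the
  product gives the rest.\<close>

lemma qmult_assoc:
  assumes "q \<noteq> 0"
  shows "qmult q (qmult q f g) h = qmult q f (qmult q g h)"
proof (induction f rule: qelem_induct)
  case (single a u)
  show ?case
  proof (induction g rule: qelem_induct)
    case (single b v)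
    show ?case
    proof (induction h rule: qelem_induct)
      case (single c w)
      show ?case
        using assms by (simp add: qmult_single_single qsig_add_left qsig_add_right power_int_add
            power_int_diff power_int_minus add.assoc field_simps)
    qed (simp_all add: qmult_add_left qmult_add_right)
  qed (simp_all add: qmult_add_left qmult_add_right)
qed (simp_all add: qmult_add_left qmult_add_right)

lemma qmult_one [simp]: "qmult q qone f = f" "qmult q f qone = f"
proof -
  show "qmult q qone f = f"
    by (induction f rule: qelem_induct) (simp_all add: qmult_add_right qscalar_def qmult_single_single del: single_one)
  show "qmult q f qone = f"
    by (induction f rule: qelem_induct) (simp_all add: qmult_add_left qscalar_def qmult_single_single del: single_one)
qed

lemma lookup_qscalar_qmult: "Poly_Mapping.lookup (qmult q (qscalar c) f) e = c * Poly_Mapping.lookup f e"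
  by (induction f rule: qelem_induct)
     (simp_all add: qmult_add_right qscalar_def qmult_single_single lookup_add distrib_left lookup_single when_def)

lemma qscalar_commute: "qmult q (qscalar c) f = qmult q f (qscalar c)"
  by (induction f rule: qelem_induct)
     (simp_all add: qmult_add_left qmult_add_right qscalar_def qmult_single_single mult.commute)

lemma QT_qmult: "f \<in> QT n \<Longrightarrow> g \<in> QT n \<Longrightarrow> qmult q f g \<in> QT n"
  unfolding qmult_def by (intro QT_sum QT_single qexps_add) (auto simp: QT_iff)

lemma lookup_qmult:
  "Poly_Mapping.lookup (qmult q f g) e = (\<Sum>a\<in>Poly_Mapping.keys f. \<Sum>c\<in>Poly_Mapping.keys g.
     (if a + c = e then Poly_Mapping.lookup f a * Poly_Mapping.lookup g c * q powi (- qsig a c) else 0))"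
  unfolding qmult_def lookup_sum lookup_single when_def by simp

lemma keys_qmult: "Poly_Mapping.keys (qmult q f g) \<subseteq> {a + c | a c. a \<in> Poly_Mapping.keys f \<and> c \<in> Poly_Mapping.keys g}"
proof
  fix e assume "e \<in> Poly_Mapping.keys (qmult q f g)"
  then have "(\<Sum>a\<in>Poly_Mapping.keys f. \<Sum>c\<in>Poly_Mapping.keys g.
     (if a + c = e then Poly_Mapping.lookup f a * Poly_Mapping.lookup g c * q powi (- qsig a c) else 0)) \<noteq> 0"
    unfolding in_keys_iff lookup_qmult .
  then obtain a where a: "a \<in> Poly_Mapping.keys f" "(\<Sum>c\<in>Poly_Mapping.keys g.
     (if a + c = e then Poly_Mapping.lookup f a * Poly_Mapping.lookup g c * q powi (- qsig a c) else 0)) \<noteq> 0"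
    by (rule sum.not_neutral_contains_not_neutral)
  from a(2) obtain c where "c \<in> Poly_Mapping.keys g" "a + c = e"
    by (elim sum.not_neutral_contains_not_neutral) (auto split: if_splits)
  with a show "e \<in> {a + c | a c. a \<in> Poly_Mapping.keys f \<and> c \<in> Poly_Mapping.keys g}" by auto
qed

text \<open>Comparing exponents through an injective homomorphism \<open>\<kappa>\<close> into the lexicographic order
  covers all the monomial orders that are needed.\<close>

locale exp_order =
  fixes \<kappa> :: "qexp \<Rightarrow> qexp"
  assumes kappa_inj: "inj \<kappa>" and kappa_add: "\<kappa> (a + b) = \<kappa> a + \<kappa> b"
begin

text \<open>The leading datum is stored as a value of \<kappa>, not as an exponent, so that it adds
  under products directly. For f = 0 it is the unspecified maximum of the empty set, which is why
  nonvanishing is assumed throughout.\<close>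

definition top_exp :: "qelem \<Rightarrow> qexp" where
  "top_exp f = Max (\<kappa> ` Poly_Mapping.keys f)"

lemma kappa_zero: "\<kappa> 0 = 0" using kappa_add[of 0 0] by simp
lemma kappa_uminus: "\<kappa> (- a) = - \<kappa> a"
  using kappa_add[of a "- a"] kappa_zero by (simp add: eq_neg_iff_add_eq_0 add.commute)

lemma le_top_exp: "e \<in> Poly_Mapping.keys f \<Longrightarrow> \<kappa> e \<le> top_exp f"
  by (simp add: top_exp_def)

lemma top_exp_attained:
  assumes "f \<noteq> 0" obtains e where "e \<in> Poly_Mapping.keys f" "\<kappa> e = top_exp f"
proof -
  have "Max (\<kappa> ` Poly_Mapping.keys f) \<in> \<kappa> ` Poly_Mapping.keys f"
    using assms by (intro Max_in) auto
  then show thesis using that by (auto simp: top_exp_def)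
qed

lemma top_exp_eqI: "e \<in> Poly_Mapping.keys f \<Longrightarrow> (\<And>c. c \<in> Poly_Mapping.keys f \<Longrightarrow> \<kappa> c \<le> \<kappa> e) \<Longrightarrow> top_exp f = \<kappa> e"
  unfolding top_exp_def by (rule Max_eqI) auto

text \<open>No other pair of exponents contributes to a + c: both summands are bounded by the
  leading ones, so equality of the sums forces equality of each, and \<kappa> is injective. Leading
  terms therefore never cancel.\<close>

lemma lookup_qmult_top:
  assumes a: "a \<in> Poly_Mapping.keys f" "\<kappa> a = top_exp f" and c: "c \<in> Poly_Mapping.keys g" "\<kappa> c = top_exp g"
  shows "Poly_Mapping.lookup (qmult q f g) (a + c) =
    Poly_Mapping.lookup f a * Poly_Mapping.lookup g c * q powi (- qsig a c)"
proof -
  have uniq: "a' = a \<and> c' = c" if "a' \<in> Poly_Mapping.keys f" "c' \<in> Poly_Mapping.keys g" "a' + c' = a + c" for a' c'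
  proof -
    have eq: "\<kappa> a' + \<kappa> c' = \<kappa> a + \<kappa> c" using arg_cong[OF that(3), of \<kappa>] unfolding kappa_add .
    have le: "\<kappa> a' \<le> \<kappa> a" "\<kappa> c' \<le> \<kappa> c"
      using le_top_exp[OF that(1)] le_top_exp[OF that(2)] unfolding a(2) c(2) .
    have "\<not> \<kappa> a' < \<kappa> a"
      using add_less_le_mono[OF _ le(2), of "\<kappa> a'" "\<kappa> a"] unfolding eq by blast
    then have "\<kappa> a' = \<kappa> a" by (rule antisym_conv1[THEN iffD1, OF _ le(1)])
    then have "a' = a" by (rule injD[OF kappa_inj])
    with that(3) show ?thesis by simp
  qed
  have "Poly_Mapping.lookup (qmult q f g) (a + c) = (\<Sum>a'\<in>Poly_Mapping.keys f. \<Sum>c'\<in>Poly_Mapping.keys g.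
     (if a' = a \<and> c' = c then Poly_Mapping.lookup f a * Poly_Mapping.lookup g c * q powi (- qsig a c) else 0))"
    unfolding lookup_qmult by (intro sum.cong refl) (use uniq in auto)
  also have "\<dots> = (\<Sum>a'\<in>Poly_Mapping.keys f. if a' = a then (\<Sum>c'\<in>Poly_Mapping.keys g.
     (if c' = c then Poly_Mapping.lookup f a * Poly_Mapping.lookup g c * q powi (- qsig a c) else 0)) else 0)"
    by (intro sum.cong refl) auto
  finally show ?thesis using a c by (simp add: sum.delta)
qed

lemma top_exp_qmult:
  assumes "q \<noteq> 0" "f \<noteq> 0" "g \<noteq> 0"
  shows "qmult q f g \<noteq> 0 \<and> top_exp (qmult q f g) = top_exp f + top_exp g"
proof -
  obtain a c where a: "a \<in> Poly_Mapping.keys f" "\<kappa> a = top_exp f" and c: "c \<in> Poly_Mapping.keys g" "\<kappa> c = top_exp g"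
    using assms top_exp_attained by metis
  have "Poly_Mapping.lookup (qmult q f g) (a + c) \<noteq> 0"
    using lookup_qmult_top[OF a c, of q] a(1) c(1) assms(1) by (auto simp: in_keys_iff)
  then have in_keys: "a + c \<in> Poly_Mapping.keys (qmult q f g)" by (simp add: in_keys_iff)
  have "top_exp (qmult q f g) = \<kappa> (a + c)"
  proof (rule top_exp_eqI[OF in_keys])
    fix e assume "e \<in> Poly_Mapping.keys (qmult q f g)"
    then obtain a' c' where "e = a' + c'" "a' \<in> Poly_Mapping.keys f" "c' \<in> Poly_Mapping.keys g"
      using keys_qmult by blast
    then show "\<kappa> e \<le> \<kappa> (a + c)" using le_top_exp a(2) c(2) by (auto simp: kappa_add intro!: add_mono)
  qed
  then show ?thesis using in_keys a c by (auto simp: kappa_add)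
qed

end

interpretation lex: exp_order "\<lambda>e. e"
  by unfold_locales auto

lemma qmult_eq_0_iff: "q \<noteq> 0 \<Longrightarrow> qmult q f g = 0 \<longleftrightarrow> f = 0 \<or> g = 0"
  using lex.top_exp_qmult by auto

section \<open>The Ore condition\<close>

text \<open>Gaussian elimination by induction on the set of equations. If equation y has a nonzero
  coefficient at p, it is used to eliminate the unknown p; the value at p is recovered from that
  equation afterwards.\<close>

lemma homogeneous_system_nontrivial:
  fixes M :: "'x \<Rightarrow> 'y \<Rightarrow> 'a::field"
  assumes "finite Y" "finite X" "card Y < card X"
  shows "\<exists>u. (\<exists>x\<in>X. u x \<noteq> 0) \<and> (\<forall>y\<in>Y. (\<Sum>x\<in>X. u x * M x y) = 0)"
  using assms
proof (induction Y arbitrary: X M rule: finite_induct)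
  case empty
  then obtain x where "x \<in> X" by fastforce
  then show ?case by (intro exI[of _ "\<lambda>_. 1"]) auto
next
  case (insert y Y)
  show ?case
  proof (cases "\<forall>x\<in>X. M x y = 0")
    case True
    obtain u where "\<exists>x\<in>X. u x \<noteq> 0" "\<forall>z\<in>Y. (\<Sum>x\<in>X. u x * M x z) = 0"
      using insert.IH[of X M] insert.prems insert.hyps by auto
    with True show ?thesis by (intro exI[of _ u]) auto
  next
    case False
    then obtain p where p: "p \<in> X" "M p y \<noteq> 0" by blast
    \<comment> \<open>The remaining equations after subtracting the multiple of the pivot row p that
      clears column y.\<close>
    define M' where "M' = (\<lambda>x z. M x z - M x y / M p y * M p z)"
    have "card Y < card (X - {p})" using insert.prems insert.hyps p by simp
    then obtain u where u: "\<exists>x\<in>X - {p}. u x \<noteq> 0" "\<forall>z\<in>Y. (\<Sum>x\<in>X - {p}. u x * M' x z) = 0"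
      using insert.IH[of "X - {p}" M'] insert.prems by auto
    define u' where "u' = u(p := - (\<Sum>x\<in>X - {p}. u x * M x y) / M p y)"
    have split: "(\<Sum>x\<in>X. u' x * M x z) = u' p * M p z + (\<Sum>x\<in>X - {p}. u x * M x z)" for z
      using p insert.prems by (subst sum.remove[of X p]) (auto simp: u'_def intro: sum.cong)
    have "(\<Sum>x\<in>X. u' x * M x z) = 0" if "z \<in> Y" for z
    proof -
      have "0 = (\<Sum>x\<in>X - {p}. u x * M' x z)" using u(2) that by simp
      also have "\<dots> = (\<Sum>x\<in>X - {p}. u x * M x z) - (\<Sum>x\<in>X - {p}. u x * M x y) * (M p z / M p y)"
        by (simp add: M'_def right_diff_distrib sum_subtractf sum_distrib_right sum_distrib_left mult_ac sum_divide_distrib)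
      finally show ?thesis unfolding split by (simp add: u'_def)
    qed
    moreover have "(\<Sum>x\<in>X. u' x * M x y) = 0"
      unfolding split using p by (simp add: u'_def)
    moreover have "\<exists>x\<in>X. u' x \<noteq> 0" using u(1) by (auto simp: u'_def)
    ultimately show ?thesis by (intro exI[of _ u']) auto
  qed
qed

section \<open>Boxes of exponents and their polynomial growth\<close>

definition exp_box :: "nat \<Rightarrow> nat \<Rightarrow> qexp set" where
  "exp_box n C = {e \<in> qexps n. \<forall>i. \<bar>Poly_Mapping.lookup e i\<bar> \<le> int C}"

lemma exp_box_bij:
  "bij_betw (\<lambda>e. restrict (Poly_Mapping.lookup e) {..<2*n}) (exp_box n C) ({..<2*n} \<rightarrow>\<^sub>E {- int C..int C})"
proof (rule bij_betw_byWitness[where f' = "\<lambda>h. Abs_poly_mapping (\<lambda>i. if i < 2*n then h i else 0)"])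
  have fin: "finite {i. (if i < 2*n then h i else 0) \<noteq> (0::int)}" for h
    by (rule finite_subset[of _ "{..<2*n}"]) (auto split: if_splits)
  show "\<forall>e\<in>exp_box n C. Abs_poly_mapping (\<lambda>i. if i < 2*n then restrict (Poly_Mapping.lookup e) {..<2*n} i else 0) = e"
  proof
    fix e assume e: "e \<in> exp_box n C"
    show "Abs_poly_mapping (\<lambda>i. if i < 2*n then restrict (Poly_Mapping.lookup e) {..<2*n} i else 0) = e"
      using e by (intro poly_mapping_eqI, subst lookup_Abs_poly_mapping[OF fin])
        (auto simp: exp_box_def qexps_iff)
  qed
  show "\<forall>h\<in>{..<2*n} \<rightarrow>\<^sub>E {- int C..int C}.
      restrict (Poly_Mapping.lookup (Abs_poly_mapping (\<lambda>i. if i < 2*n then h i else 0))) {..<2*n} = h"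
    by (auto simp: fin fun_eq_iff PiE_def extensional_def)
  show "(\<lambda>e. restrict (Poly_Mapping.lookup e) {..<2*n}) ` exp_box n C \<subseteq> {..<2*n} \<rightarrow>\<^sub>E {- int C..int C}"
    by (auto simp: exp_box_def abs_le_iff minus_le_iff split: if_splits)
  show "(\<lambda>h. Abs_poly_mapping (\<lambda>i. if i < 2*n then h i else 0)) ` ({..<2*n} \<rightarrow>\<^sub>E {- int C..int C}) \<subseteq> exp_box n C"
    by (auto simp: exp_box_def qexps_iff fin PiE_def Pi_def abs_le_iff minus_le_iff)
qed

lemma finite_exp_box [simp]: "finite (exp_box n C)"
  using bij_betw_finite[OF exp_box_bij[of n C]] by (simp add: finite_PiE)

lemma card_exp_box: "card (exp_box n C) = (2 * C + 1) ^ (2 * n)"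
proof -
  have "card (exp_box n C) = card ({..<2*n} \<rightarrow>\<^sub>E {- int C..int C})"
    by (rule bij_betw_same_card[OF exp_box_bij])
  also have "\<dots> = (2 * C + 1) ^ (2 * n)"
    by (simp add: card_PiE nat_add_distrib nat_mult_distrib)
  finally show ?thesis .
qed

lemma exp_box_mono: "C \<le> D \<Longrightarrow> exp_box n C \<subseteq> exp_box n D"
  unfolding exp_box_def by (auto intro: order_trans)

lemma exp_box_add:
  assumes "a \<in> exp_box n C" "b \<in> exp_box n D" shows "a + b \<in> exp_box n (C + D)"
proof -
  have "\<bar>Poly_Mapping.lookup a i + Poly_Mapping.lookup b i\<bar> \<le> int C + int D" for i
  proof -
    have "\<bar>Poly_Mapping.lookup a i\<bar> \<le> int C" "\<bar>Poly_Mapping.lookup b i\<bar> \<le> int D"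
      using assms by (auto simp: exp_box_def)
    then show ?thesis by linarith
  qed
  then show ?thesis using assms by (simp add: exp_box_def qexps_add lookup_add)
qed

lemma finite_subset_exp_box:
  assumes "finite E" "E \<subseteq> qexps n" shows "\<exists>C. E \<subseteq> exp_box n C"
  using assms
proof (induction E rule: finite_induct)
  case (insert e E)
  then obtain C where C: "E \<subseteq> exp_box n C" by auto
  define D where "D = (\<Sum>i\<in>Poly_Mapping.keys e. nat \<bar>Poly_Mapping.lookup e i\<bar>)"
  have "\<bar>Poly_Mapping.lookup e i\<bar> \<le> int D" for i
  proof (cases "i \<in> Poly_Mapping.keys e")
    case True
    then have "nat \<bar>Poly_Mapping.lookup e i\<bar> \<le> D" unfolding D_def by (intro member_le_sum) auto
    then show ?thesis by linarith
  qed (simp add: in_keys_iff)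
  then have "e \<in> exp_box n D" using insert by (simp add: exp_box_def)
  then have "insert e E \<subseteq> exp_box n (max C D)"
    using C exp_box_mono[of C "max C D" n] exp_box_mono[of D "max C D" n] by auto
  then show ?case by blast
qed auto

text \<open>The number of exponents in a box is a polynomial in its size, so enlarging a large box
  by a constant multiplies this number by a factor close to 1.\<close>

lemma exp_box_growth: "\<exists>N. card (exp_box n (N + C)) < 2 * card (exp_box n N)"
proof
  define d where "d = 2 * n"
  \<comment> \<open>Chosen for Bernoulli's inequality: 1 - x is the ratio of the two side lengths,
    and d x = 2dC / (4dC + 2C + 1) is below 1/2.\<close>
  define N where "N = 2 * d * C"
  define x where "x = real (2 * C) / real (2 * N + 2 * C + 1)"
  have "1 + real d * (- x) \<le> (1 + - x) ^ d"
    by (rule Bernoulli_inequality) (simp add: x_def)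
  moreover have "real d * x < 1 / 2"
  proof -
    have "real d * x = (real d * real (2 * C)) / real (2 * N + 2 * C + 1)" by (simp add: x_def)
    also have "\<dots> < 1 / 2" by (subst divide_less_eq) (simp add: N_def not_less add_nonneg_nonneg)
    finally show ?thesis .
  qed
  moreover have "1 + - x = real (2 * N + 1) / real (2 * N + 2 * C + 1)"
    by (simp add: x_def field_simps)
  ultimately have "1 / 2 < (real (2 * N + 1) / real (2 * N + 2 * C + 1)) ^ d" by simp
  then have "real ((2 * N + 2 * C + 1) ^ d) < real (2 * (2 * N + 1) ^ d)"
    by (simp add: power_divide field_simps)
  then have "(2 * N + 2 * C + 1) ^ d < 2 * (2 * N + 1) ^ d" by linarith
  then show "card (exp_box n (N + C)) < 2 * card (exp_box n N)"
    by (simp add: card_exp_box d_def algebra_simps)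
qed

text \<open>Dimension count. Pairs (a, c) supported in the box of size N form a space of dimension
  twice the size of the box, while a f - c g is supported in the box of size N + C, which has fewer
  elements. So some nonzero pair satisfies a f = c g, and the absence of zero divisors makes both
  entries nonzero.\<close>

lemma qmult_Ore:
  assumes q: "q \<noteq> 0" and f: "f \<in> QT n" "f \<noteq> 0" and g: "g \<in> QT n" "g \<noteq> 0"
  obtains a c where "a \<in> QT n" "c \<in> QT n" "a \<noteq> 0" "c \<noteq> 0" "qmult q a f = qmult q c g"
proof -
  obtain C where C: "Poly_Mapping.keys f \<union> Poly_Mapping.keys g \<subseteq> exp_box n C"
    using finite_subset_exp_box[of "Poly_Mapping.keys f \<union> Poly_Mapping.keys g" n] f g by (auto simp: QT_iff)
  obtain N where N: "card (exp_box n (N + C)) < 2 * card (exp_box n N)" using exp_box_growth by blast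
  \<comment> \<open>The unknowns are the coefficients of a (marked \<open>True\<close>) and of c
    (marked \<open>False\<close>); the minus sign of the equation is put on g.\<close>
  define X where "X = exp_box n N \<times> (UNIV :: bool set)"
  define M where "M = (\<lambda>x y. Poly_Mapping.lookup (qmult q (Poly_Mapping.single (fst x) 1) (if snd x then f else - g)) y)"
  have "finite X" "card (exp_box n (N + C)) < card X"
    using N by (auto simp: X_def card_cartesian_product)
  then obtain u where u: "\<exists>x\<in>X. u x \<noteq> 0" "\<forall>y\<in>exp_box n (N + C). (\<Sum>x\<in>X. u x * M x y) = 0"
    using homogeneous_system_nontrivial[of "exp_box n (N + C)" X M] by auto
  define a where "a = (\<Sum>e\<in>exp_box n N. Poly_Mapping.single e (u (e, True)))"
  define c where "c = (\<Sum>e\<in>exp_box n N. Poly_Mapping.single e (u (e, False)))"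
  have lookup_a: "Poly_Mapping.lookup a e = u (e, True)" if "e \<in> exp_box n N" for e
    using that by (simp add: a_def lookup_sum lookup_single when_def sum.delta)
  have lookup_c: "Poly_Mapping.lookup c e = u (e, False)" if "e \<in> exp_box n N" for e
    using that by (simp add: c_def lookup_sum lookup_single when_def sum.delta)
  have QT: "a \<in> QT n" "c \<in> QT n"
    unfolding a_def c_def by (auto intro!: QT_sum QT_single simp: exp_box_def)
  have lookup_part: "Poly_Mapping.lookup (qmult q (\<Sum>e\<in>exp_box n N. Poly_Mapping.single e (v e)) h) y
      = (\<Sum>e\<in>exp_box n N. v e * Poly_Mapping.lookup (qmult q (Poly_Mapping.single e 1) h) y)" for v h y
  proof -
    have "Poly_Mapping.single e (v e) = qmult q (qscalar (v e)) (Poly_Mapping.single e 1)" for e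
      by (simp add: qscalar_def qmult_single_single)
    then show ?thesis
      by (simp add: qmult_sum_left lookup_sum qmult_assoc[OF q] lookup_qscalar_qmult)
  qed
  have "Poly_Mapping.lookup (qmult q a f - qmult q c g) y = 0" for y
  proof (cases "y \<in> exp_box n (N + C)")
    case True
    have "Poly_Mapping.lookup (qmult q a f - qmult q c g) y = (\<Sum>x\<in>X. u x * M x y)"
      by (simp add: X_def UNIV_bool lookup_minus a_def c_def lookup_part M_def sum.cartesian_product'
           qmult_uminus_right sum_subtractf)
    with u(2) True show ?thesis by simp
  next
    case False
    have "Poly_Mapping.keys a \<subseteq> exp_box n N" "Poly_Mapping.keys c \<subseteq> exp_box n N"
      unfolding a_def c_def using keys_sum by (force simp: lookup_sum lookup_single in_keys_iff when_def sum.delta split: if_splits)+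
    then have "y \<notin> Poly_Mapping.keys (qmult q a f)" "y \<notin> Poly_Mapping.keys (qmult q c g)"
      using False C keys_qmult[of q a f] keys_qmult[of q c g] exp_box_add[of _ n N _ C] by blast+
    then show ?thesis by (simp add: in_keys_iff lookup_minus)
  qed
  then have eq: "qmult q a f = qmult q c g"
    by (metis eq_iff_diff_eq_0 lookup_zero poly_mapping_eqI)
  have "a \<noteq> 0 \<or> c \<noteq> 0"
  proof -
    obtain e s where "e \<in> exp_box n N" "u (e, s) \<noteq> 0" using u(1) by (auto simp: X_def)
    then show ?thesis using lookup_a lookup_c by (cases s) force+
  qed
  then have "a \<noteq> 0" "c \<noteq> 0"
    using eq f g qmult_eq_0_iff[OF q] qmult_zero by metis+
  then show thesis using that QT eq by blast
qed

section \<open>A common eigenvector in a left ideal\<close>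

text \<open>Index 0 is the most significant one in the lexicographic order on finitely supported
  functions.\<close>

lemma lookup_zero_mono:
  fixes x y :: qexp assumes "x \<le> y" shows "Poly_Mapping.lookup x 0 \<le> Poly_Mapping.lookup y 0"
  using assms
  by (auto simp: less_eq_poly_mapping.rep_eq less_fun_def poly_mapping_eq_iff[symmetric])
     (metis less_imp_le not_gr_zero order_refl)

text \<open>Swapping indices 0 and i makes coordinate i the most significant one. Together with the
  negated order it turns leading exponents into bounds from above and below for this
  coordinate.\<close>

definition coord_first :: "nat \<Rightarrow> qexp \<Rightarrow> qexp" where
  "coord_first i = Poly_Mapping.map_key (Transposition.transpose 0 i)"

lemma lookup_coord_first_zero: "Poly_Mapping.lookup (coord_first i e) 0 = Poly_Mapping.lookup e i"
  by (simp add: coord_first_def map_key.rep_eq)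

lemma coord_first_add: "coord_first i (a + b) = coord_first i a + coord_first i b"
  by (simp add: coord_first_def map_key_plus)

lemma inj_coord_first: "inj (coord_first i)"
proof (rule injI)
  fix a b assume "coord_first i a = coord_first i b"
  then have "Poly_Mapping.map_key (Transposition.transpose 0 i) (coord_first i a)
      = Poly_Mapping.map_key (Transposition.transpose 0 i) (coord_first i b)" by simp
  then show "a = b" by (simp add: coord_first_def map_key_compose map_key_id[folded id_def])
qed

lemma exp_order_coord_first: "exp_order (coord_first i)"
  by unfold_locales (simp_all add: inj_coord_first coord_first_add)

lemma exp_order_neg_coord_first: "exp_order (\<lambda>e. - coord_first i e)"
  by unfold_locales (auto simp: coord_first_add inj_def dest: injD[OF inj_coord_first])

section \<open>Automorphisms of a left ideal and their effect on leading exponents\<close>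

locale qleft_ideal =
  fixes q :: complex and n :: nat and I :: "qelem set"
  assumes q_nonzero: "q \<noteq> 0"
    and ideal_QT: "I \<subseteq> QT n"
    and ideal_diff: "x \<in> I \<Longrightarrow> y \<in> I \<Longrightarrow> x - y \<in> I"
    and ideal_qmult: "a \<in> QT n \<Longrightarrow> x \<in> I \<Longrightarrow> qmult q a x \<in> I"
begin

lemma ideal_keys: "x \<in> I \<Longrightarrow> Poly_Mapping.keys x \<subseteq> qexps n"
  using ideal_QT by (meson QT_iff subsetD)

definition ideal_aut :: "(qelem \<Rightarrow> qelem) \<Rightarrow> (qelem \<Rightarrow> qelem) \<Rightarrow> bool" where
  "ideal_aut R R' \<longleftrightarrow> (\<forall>x\<in>I. R x \<in> I \<and> R' x \<in> I \<and> R' (R x) = x \<and> R (R' x) = x) \<and>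
     (\<forall>a\<in>QT n. \<forall>x\<in>I. R (qmult q a x) = qmult q a (R x) \<and> R' (qmult q a x) = qmult q a (R' x))"

lemma ideal_aut_sym: "ideal_aut R R' \<Longrightarrow> ideal_aut R' R"
  by (simp add: ideal_aut_def)

lemma ideal_aut_nonzero:
  assumes R: "ideal_aut R R'" and x: "x \<in> I" "x \<noteq> 0"
  shows "R x \<noteq> 0"
proof
  assume "R x = 0"
  have "R' (qmult q 0 x) = qmult q 0 (R' x)"
    using R x(1) QT_zero unfolding ideal_aut_def by blast
  then have "R' 0 = 0" by simp
  with \<open>R x = 0\<close> R x show False by (metis ideal_aut_def)
qed

text \<open>Choose a common multiple a x = c z. Applying R gives a (R x) = c (R z), and the leading
  exponents of a and c drop out when the two equations are compared.\<close>

lemma ideal_aut_shift: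
  assumes R: "ideal_aut R R'" and \<kappa>: "exp_order \<kappa>" and x: "x \<in> I" "x \<noteq> 0" and z: "z \<in> I" "z \<noteq> 0"
  shows "exp_order.top_exp \<kappa> (R x) - exp_order.top_exp \<kappa> x
       = exp_order.top_exp \<kappa> (R z) - exp_order.top_exp \<kappa> z"
proof -
  interpret exp_order \<kappa> by (rule \<kappa>)
  obtain a c where ac: "a \<in> QT n" "c \<in> QT n" "a \<noteq> 0" "c \<noteq> 0" "qmult q a x = qmult q c z"
    using qmult_Ore[OF q_nonzero, of x n z] x z ideal_QT by blast
  then have R_eq: "qmult q a (R x) = qmult q c (R z)"
    using R x z unfolding ideal_aut_def by metis
  have "top_exp a + top_exp x = top_exp c + top_exp z"
    using top_exp_qmult[OF q_nonzero, of a x] top_exp_qmult[OF q_nonzero, of c z] ac x z by simp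
  moreover have "top_exp a + top_exp (R x) = top_exp c + top_exp (R z)"
    using top_exp_qmult[OF q_nonzero, of a "R x"] top_exp_qmult[OF q_nonzero, of c "R z"] ac R_eq
      ideal_aut_nonzero[OF R] x z by simp
  ultimately show ?thesis by (metis add_diff_cancel_left)
qed

text \<open>The value is taken at an arbitrary nonzero element of the ideal; by
  \<open>ideal_aut_shift\<close> any other nonzero element gives the same.\<close>

definition shift :: "(qexp \<Rightarrow> qexp) \<Rightarrow> (qelem \<Rightarrow> qelem) \<Rightarrow> qexp" where
  "shift \<kappa> R = (let x = (SOME x. x \<in> I \<and> x \<noteq> 0) in
     exp_order.top_exp \<kappa> (R x) - exp_order.top_exp \<kappa> x)"

lemma top_exp_ideal_aut:
  assumes R: "ideal_aut R R'" and \<kappa>: "exp_order \<kappa>" and x: "x \<in> I" "x \<noteq> 0"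
  shows "exp_order.top_exp \<kappa> (R x) = exp_order.top_exp \<kappa> x + shift \<kappa> R"
proof -
  have some: "(SOME x. x \<in> I \<and> x \<noteq> 0) \<in> I \<and> (SOME x. x \<in> I \<and> x \<noteq> 0) \<noteq> 0"
    by (rule someI[of "\<lambda>x. x \<in> I \<and> x \<noteq> 0"]) (use x in auto)
  then have "shift \<kappa> R = exp_order.top_exp \<kappa> (R x) - exp_order.top_exp \<kappa> x"
    unfolding shift_def Let_def by (intro ideal_aut_shift[OF R \<kappa> _ _ x]) auto
  then show ?thesis by simp
qed

lemma shift_inverse:
  assumes R: "ideal_aut R R'" and \<kappa>: "exp_order \<kappa>" and x: "x \<in> I" "x \<noteq> 0"
  shows "shift \<kappa> R' = - shift \<kappa> R"
proof -
  have "exp_order.top_exp \<kappa> (R' (R x)) = exp_order.top_exp \<kappa> x + shift \<kappa> R + shift \<kappa> R'"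
    using R x top_exp_ideal_aut[OF R \<kappa> x] top_exp_ideal_aut[OF ideal_aut_sym[OF R] \<kappa>, of "R x"]
      ideal_aut_nonzero[OF R] by (auto simp: ideal_aut_def)
  moreover have "R' (R x) = x" using R x by (simp add: ideal_aut_def)
  ultimately have "shift \<kappa> R + shift \<kappa> R' = 0" by (simp add: add.assoc)
  then show ?thesis by (simp add: eq_neg_iff_add_eq_0 add.commute)
qed

lemma ideal_aut_iterate:
  assumes R: "ideal_aut R R'" and x: "x \<in> I" "x \<noteq> 0"
  shows "(R ^^ k) x \<in> I \<and> (R ^^ k) x \<noteq> 0"
  using x ideal_aut_nonzero[OF R] R by (induction k) (auto simp: ideal_aut_def)

lemma top_exp_iterate:
  assumes R: "ideal_aut R R'" and \<kappa>: "exp_order \<kappa>" and x: "x \<in> I" "x \<noteq> 0"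
  shows "Poly_Mapping.lookup (exp_order.top_exp \<kappa> ((R ^^ k) x)) i
       = Poly_Mapping.lookup (exp_order.top_exp \<kappa> x) i + int k * Poly_Mapping.lookup (shift \<kappa> R) i"
  using top_exp_ideal_aut[OF R \<kappa>] ideal_aut_iterate[OF R x]
  by (induction k) (simp_all add: lookup_add algebra_simps)

text \<open>The lexicographic leading exponent of R^k x belongs to its support, so its
  \<kappa>-value is at most the leading one for \<kappa>. In the front coordinate both are affine
  functions of k, with slopes the two sides of the claim, and an inequality for all k passes to the
  slopes.\<close>

lemma shift_le:
  assumes R: "ideal_aut R R'" and \<kappa>: "exp_order \<kappa>" and x: "x \<in> I" "x \<noteq> 0"
  shows "Poly_Mapping.lookup (\<kappa> (shift (\<lambda>e. e) R)) 0 \<le> Poly_Mapping.lookup (shift \<kappa> R) 0"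
proof -
  interpret exp_order \<kappa> by (rule \<kappa>)
  let ?c = "Poly_Mapping.lookup (\<kappa> (shift (\<lambda>e. e) R)) 0" and ?c' = "Poly_Mapping.lookup (shift \<kappa> R) 0"
  define a where "a = Poly_Mapping.lookup (\<kappa> (lex.top_exp x)) 0"
  define a' where "a' = Poly_Mapping.lookup (top_exp x) 0"
  have step: "a + int k * ?c \<le> a' + int k * ?c'" for k
  proof -
    have y: "(R ^^ k) x \<in> I" "(R ^^ k) x \<noteq> 0" using ideal_aut_iterate[OF R x] by auto
    have "lex.top_exp ((R ^^ k) x) \<in> Poly_Mapping.keys ((R ^^ k) x)"
      using lex.top_exp_attained[OF y(2)] by metis
    then have "Poly_Mapping.lookup (\<kappa> (lex.top_exp ((R ^^ k) x))) 0 \<le> Poly_Mapping.lookup (top_exp ((R ^^ k) x)) 0"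
      by (intro lookup_zero_mono le_top_exp)
    moreover have "Poly_Mapping.lookup (\<kappa> (lex.top_exp ((R ^^ k) x))) 0 = a + int k * ?c"
    proof (induction k)
      case (Suc k)
      have "lex.top_exp (R ((R ^^ k) x)) = lex.top_exp ((R ^^ k) x) + shift (\<lambda>e. e) R"
        using ideal_aut_iterate[OF R x, of k] by (intro top_exp_ideal_aut[OF R lex.exp_order_axioms]) auto
      then show ?case using Suc by (simp add: kappa_add lookup_add algebra_simps)
    qed (simp add: a_def)
    ultimately show ?thesis using top_exp_iterate[OF R \<kappa> x] by (simp add: a'_def)
  qed
  show ?thesis
  proof (rule ccontr)
    assume "\<not> ?thesis"
    then have "?c - ?c' \<ge> 1" by simp
    then have "int k \<le> int k * (?c - ?c')" for k by (simp add: mult_le_cancel_left1)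
    \<comment> \<open>With k one larger than the initial gap a' - a, a slope difference of at least
      1 has already overtaken the gap.\<close>
    then have "int (nat (a' - a + 1)) \<le> int (nat (a' - a + 1)) * (?c - ?c')" by blast
    moreover have "int (nat (a' - a + 1)) * (?c - ?c') \<le> a' - a"
      using step[of "nat (a' - a + 1)"] by (simp add: right_diff_distrib)
    ultimately show False by linarith
  qed
qed

text \<open>Applying \<open>shift_le\<close> to an automorphism and to its inverse shows that an automorphism
  translates the Newton polytope of every element of the ideal by one and the same vector.\<close>

lemma shift_coord:
  assumes R: "ideal_aut R R'" and \<kappa>: "exp_order \<kappa>" and x: "x \<in> I" "x \<noteq> 0"
  shows "Poly_Mapping.lookup (shift \<kappa> R) 0 = Poly_Mapping.lookup (\<kappa> (shift (\<lambda>e. e) R)) 0"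
  using shift_le[OF R \<kappa> x] shift_le[OF ideal_aut_sym[OF R] \<kappa> x]
  by (simp add: shift_inverse[OF R \<kappa> x] shift_inverse[OF R lex.exp_order_axioms x]
      exp_order.kappa_uminus[OF \<kappa>])

text \<open>Every exponent of R x is bounded by its leading one, which in the front coordinate is
  that of x plus the corresponding coordinate of the lexicographic shift. That one vector serves
  every order \<kappa> is the point of \<open>shift_coord\<close>.\<close>

lemma untwisted_keys_le:
  assumes R: "ideal_aut R R'" and \<kappa>: "exp_order \<kappa>" and x: "x \<in> I" "x \<noteq> 0"
    and e: "e \<in> Poly_Mapping.keys (R x)"
  shows "\<exists>e'\<in>Poly_Mapping.keys x. Poly_Mapping.lookup (\<kappa> (e - shift (\<lambda>e. e) R)) 0 \<le> Poly_Mapping.lookup (\<kappa> e') 0"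
proof -
  interpret exp_order \<kappa> by (rule \<kappa>)
  obtain e' where e': "e' \<in> Poly_Mapping.keys x" "\<kappa> e' = top_exp x" using top_exp_attained x by metis
  have "Poly_Mapping.lookup (\<kappa> e) 0 \<le> Poly_Mapping.lookup (top_exp (R x)) 0"
    using e by (intro lookup_zero_mono le_top_exp)
  also have "\<dots> = Poly_Mapping.lookup (\<kappa> e') 0 + Poly_Mapping.lookup (\<kappa> (shift (\<lambda>e. e) R)) 0"
    using top_exp_ideal_aut[OF R \<kappa> x] shift_coord[OF R \<kappa> x] e' by (simp add: lookup_add)
  finally have "Poly_Mapping.lookup (\<kappa> (e - shift (\<lambda>e. e) R)) 0 \<le> Poly_Mapping.lookup (\<kappa> e') 0"
    using kappa_add[of "e - shift (\<lambda>e. e) R" "shift (\<lambda>e. e) R"] by (simp add: lookup_add)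
  then show ?thesis using e' by blast
qed

definition untwist :: "(qelem \<Rightarrow> qelem) \<Rightarrow> qelem \<Rightarrow> qelem" where
  "untwist R x = qmult q (Poly_Mapping.single (- shift (\<lambda>e. e) R) 1) (R x)"

lemma shift_in_qexps:
  assumes R: "ideal_aut R R'" and x: "x \<in> I" "x \<noteq> 0"
  shows "shift (\<lambda>e. e) R \<in> qexps n"
proof -
  have "lex.top_exp y \<in> qexps n" if "y \<in> I" "y \<noteq> 0" for y
    using lex.top_exp_attained[of y] that ideal_QT by (metis QT_iff subsetD)
  moreover have "shift (\<lambda>e. e) R = lex.top_exp (R x) - lex.top_exp x"
    using top_exp_ideal_aut[OF R lex.exp_order_axioms x] by simp
  ultimately show ?thesis
    using x R ideal_aut_nonzero[OF R x] by (simp add: qexps_diff ideal_aut_def)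
qed

lemma untwist_ideal:
  assumes R: "ideal_aut R R'" and x: "x \<in> I" "x \<noteq> 0"
  shows "untwist R x \<in> I" "untwist R x \<noteq> 0" "lex.top_exp (untwist R x) = lex.top_exp x"
proof -
  let ?m = "Poly_Mapping.single (- shift (\<lambda>e. e) R) 1 :: qelem"
  have "R x \<in> I" using R x by (simp add: ideal_aut_def)
  then show "untwist R x \<in> I" unfolding untwist_def
    by (intro ideal_qmult QT_single qexps_uminus shift_in_qexps[OF R x])
  have m: "?m \<noteq> 0" by (metis lookup_single_eq lookup_zero one_neq_zero)
  have "lex.top_exp ?m = - shift (\<lambda>e. e) R"
    using lex.top_exp_attained[OF m] by auto
  then show "untwist R x \<noteq> 0" "lex.top_exp (untwist R x) = lex.top_exp x"
    using lex.top_exp_qmult[OF q_nonzero m ideal_aut_nonzero[OF R x]]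
      top_exp_ideal_aut[OF R lex.exp_order_axioms x] by (auto simp: untwist_def)
qed

lemma untwist_keys:
  assumes R: "ideal_aut R R'" and x: "x \<in> I" "x \<noteq> 0" and box: "Poly_Mapping.keys x \<subseteq> exp_box n C"
  shows "Poly_Mapping.keys (untwist R x) \<subseteq> exp_box n C"
proof
  fix e assume e: "e \<in> Poly_Mapping.keys (untwist R x)"
  then have qexps: "e \<in> qexps n"
    using ideal_keys[OF untwist_ideal(1)[OF R x]] by blast
  from e obtain d where d: "d \<in> Poly_Mapping.keys (R x)" "e = - shift (\<lambda>e. e) R + d"
    unfolding untwist_def using keys_qmult by (force simp del: neg_equal_iff_equal)
  then have ed: "e = d - shift (\<lambda>e. e) R" by simp
  have "\<bar>Poly_Mapping.lookup e i\<bar> \<le> int C" for i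
  proof -
    \<comment> \<open>The order with coordinate i in front bounds it from above by some u in the
      support of x, the negated order from below by some v.\<close>
    obtain u v where u: "u \<in> Poly_Mapping.keys x" "Poly_Mapping.lookup e i \<le> Poly_Mapping.lookup u i"
      and v: "v \<in> Poly_Mapping.keys x" "- Poly_Mapping.lookup e i \<le> - Poly_Mapping.lookup v i"
      using untwisted_keys_le[OF R exp_order_coord_first x d(1), of i]
        untwisted_keys_le[OF R exp_order_neg_coord_first x d(1), of i]
      by (auto simp: lookup_coord_first_zero ed)
    have "\<bar>Poly_Mapping.lookup u i\<bar> \<le> int C" "\<bar>Poly_Mapping.lookup v i\<bar> \<le> int C"
      using u(1) v(1) box by (auto simp: exp_box_def)
    with u(2) v(2) show ?thesis by linarith
  qed
  with qexps show "e \<in> exp_box n C" by (simp add: exp_box_def)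
qed

text \<open>Among the elements of the ideal supported in a fixed box, one with minimal leading exponent is
  an eigenvector: \<open>untwist R x0\<close> is supported in the same box and has the same leading exponent,
  so cancelling the leading terms must give 0.\<close>

theorem common_eigenvector:
  assumes nontrivial: "x \<in> I" "x \<noteq> 0"
  obtains x0 where "x0 \<in> I" "x0 \<noteq> 0" "\<And>R R'. ideal_aut R R' \<Longrightarrow> \<exists>V\<in>QT n. R x0 = qmult q V x0"
proof -
  obtain C where C: "Poly_Mapping.keys x \<subseteq> exp_box n C"
    using finite_subset_exp_box[of "Poly_Mapping.keys x" n] ideal_keys[OF nontrivial(1)] by auto
  define X where "X = {y \<in> I. y \<noteq> 0 \<and> Poly_Mapping.keys y \<subseteq> exp_box n C}"
  have top_box: "lex.top_exp y \<in> exp_box n C" if "y \<in> X" for y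
  proof -
    have "y \<noteq> 0" "Poly_Mapping.keys y \<subseteq> exp_box n C" using that by (auto simp: X_def)
    then show ?thesis using lex.top_exp_attained[of y] by (metis subsetD)
  qed
  have fin: "finite (lex.top_exp ` X)"
    by (rule finite_subset[OF image_subsetI[OF top_box] finite_exp_box])
  have "x \<in> X" using nontrivial C by (simp add: X_def)
  then have "Min (lex.top_exp ` X) \<in> lex.top_exp ` X" using fin by (intro Min_in) auto
  then obtain x0 where x0: "x0 \<in> X" "lex.top_exp x0 = Min (lex.top_exp ` X)" by auto
  have minimal: "lex.top_exp x0 \<le> lex.top_exp y" if "y \<in> X" for y
    using fin that x0(2) by simp
  have x0': "x0 \<in> I" "x0 \<noteq> 0" "Poly_Mapping.keys x0 \<subseteq> exp_box n C" using x0 by (auto simp: X_def)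
  show thesis
  proof (rule that[OF x0'(1,2)])
    fix R R' assume R: "ideal_aut R R'"
    let ?L = "lex.top_exp x0"
    define z where "z = untwist R x0"
    define \<mu> where "\<mu> = Poly_Mapping.lookup z ?L / Poly_Mapping.lookup x0 ?L"
    define w where "w = z - qmult q (qscalar \<mu>) x0"
    have L: "?L \<in> Poly_Mapping.keys x0" using lex.top_exp_attained[OF x0'(2)] by metis
    have z_top: "lex.top_exp z = ?L" and z_I: "z \<in> I"
      using untwist_ideal[OF R x0'(1,2)] by (auto simp: z_def)
    have w_keys: "Poly_Mapping.keys w \<subseteq> Poly_Mapping.keys z \<union> Poly_Mapping.keys x0"
      by (auto simp: w_def in_keys_iff lookup_minus lookup_qscalar_qmult)
    have w_L: "Poly_Mapping.lookup w ?L = 0"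
      using L by (simp add: w_def \<mu>_def lookup_minus lookup_qscalar_qmult in_keys_iff)
    have "w = 0"
    proof (rule ccontr)
      assume "w \<noteq> 0"
      have "w \<in> I" unfolding w_def using z_I x0'(1) by (intro ideal_diff ideal_qmult) auto
      then have "w \<in> X"
        using \<open>w \<noteq> 0\<close> w_keys x0'(3) untwist_keys[OF R x0'] by (auto simp: X_def z_def)
      then have "?L \<le> lex.top_exp w" by (rule minimal)
      moreover obtain e where e: "e \<in> Poly_Mapping.keys w" "e = lex.top_exp w"
        using lex.top_exp_attained[OF \<open>w \<noteq> 0\<close>] .
      moreover have "e \<le> ?L" using e(1) w_keys lex.le_top_exp z_top by (metis UnE subsetD)
      ultimately have "?L \<in> Poly_Mapping.keys w" by auto
      then show False using w_L by (simp add: in_keys_iff)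
    qed
    then have eq: "z = qmult q (qscalar \<mu>) x0" by (simp add: w_def)
    let ?S = "shift (\<lambda>e. e) R"
    have S: "?S \<in> qexps n" by (rule shift_in_qexps[OF R x0'(1,2)])
    \<comment> \<open>The product m(S) m(-S) is the scalar q^(qsig S S), so this c makes c m(S) the
      inverse of m(-S) and undoes \<open>untwist\<close>.\<close>
    define c where "c = inverse (q powi (qsig ?S ?S))"
    have "qmult q (Poly_Mapping.single ?S c) z = R x0"
    proof -
      have "qsig ?S (- ?S) = - qsig ?S ?S"
        using qsig_add_right[of ?S ?S "- ?S"] by simp
      then have "qmult q (Poly_Mapping.single ?S c) (Poly_Mapping.single (- ?S) 1) = qone"
        using q_nonzero by (simp add: qmult_single_single qscalar_def c_def)
      then show ?thesis
        by (simp add: z_def untwist_def qmult_assoc[OF q_nonzero, symmetric])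
    qed
    then have "R x0 = qmult q (qmult q (Poly_Mapping.single ?S c) (qscalar \<mu>)) x0"
      by (simp add: eq qmult_assoc[OF q_nonzero])
    moreover have "qmult q (Poly_Mapping.single ?S c) (qscalar \<mu>) \<in> QT n"
      using S by (intro QT_qmult QT_single) auto
    ultimately show "\<exists>V\<in>QT n. R x0 = qmult q V x0" by blast
  qed
qed

end

section \<open>Simplicity, bimodules and words\<close>

text \<open>The assumption on roots of unity in the form in which simplicity uses it: distinct
  integer powers of q are distinct.\<close>

lemma powi_eq_1_imp_0:
  fixes q :: complex
  assumes "q \<noteq> 0" "\<forall>k::nat. k > 0 \<longrightarrow> q ^ k \<noteq> 1" "q powi m = 1"
  shows "m = 0"
proof (rule ccontr)
  assume "m \<noteq> 0"
  have "q ^ nat \<bar>m\<bar> = 1"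
    using assms(3) by (cases "m \<ge> 0") (auto simp: power_int_def field_simps)
  with assms(2) \<open>m \<noteq> 0\<close> show False by auto
qed

text \<open>If a and c differ in one coordinate, the partner generator b of that coordinate works:
  its commutation exponent with a monomial is this coordinate up to sign. The indices below 2n are
  made of complete pairs, so b stays in range.\<close>

lemma commutation_separates:
  assumes "a \<in> qexps n" "c \<in> qexps n" "a \<noteq> c"
  obtains b where "b \<in> qexps n" "qsig b a - qsig a b \<noteq> qsig b c - qsig c b"
proof -
  obtain i where i: "Poly_Mapping.lookup a i \<noteq> Poly_Mapping.lookup c i"
    using assms(3) by (meson poly_mapping_eqI)
  then have lt: "i < 2 * n" using assms(1,2) by (metis qexps_iff not_less)
  show thesis
  proof (cases "even i")
    case True
    then obtain k where k: "i = 2 * k" by blast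
    then have "Suc (2 * k) < 2 * n" using lt by presburger
    then show thesis using i k
      by (intro that[of "Poly_Mapping.single (Suc (2 * k)) 1"])
        (simp_all add: qexps_single qsig_single_odd_left qsig_single_odd_right)
  next
    case False
    then obtain k where k: "i = Suc (2 * k)" using oddE by fastforce
    then show thesis using i lt
      by (intro that[of "Poly_Mapping.single (2 * k) 1"])
        (simp_all add: qexps_single qsig_single_even_left qsig_single_even_right)
  qed
qed

lemma lookup_single_qmult:
  "Poly_Mapping.lookup (qmult q (Poly_Mapping.single b 1) f) (b + e) = Poly_Mapping.lookup f e * q powi (- qsig b e)"
  "Poly_Mapping.lookup (qmult q f (Poly_Mapping.single b 1)) (b + e) = Poly_Mapping.lookup f e * q powi (- qsig e b)"
  by (induction f rule: qelem_induct)
    (auto simp: qmult_add_left qmult_add_right qmult_single_single lookup_add lookup_single when_def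
      distrib_right add.commute)

lemma qmult_monomial_inverse:
  assumes "q \<noteq> 0"
  shows "qmult q (Poly_Mapping.single e 1) (Poly_Mapping.single (- e) (q powi (- qsig e e))) = qone"
    and "qmult q (Poly_Mapping.single (- e) (q powi (- qsig e e))) (Poly_Mapping.single e 1) = qone"
proof -
  have "qsig e (- e) = - qsig e e" "qsig (- e) e = - qsig e e"
    using qsig_add_right[of e e "- e"] qsig_add_left[of e "- e" e] by simp_all
  then show "qmult q (Poly_Mapping.single e 1) (Poly_Mapping.single (- e) (q powi (- qsig e e))) = qone"
    "qmult q (Poly_Mapping.single (- e) (q powi (- qsig e e))) (Poly_Mapping.single e 1) = qone"
    using assms by (simp_all add: qmult_single_single qscalar_def power_int_minus)
qed

text \<open>Commuting a two-sided ideal element with a suitable monomial, after rescaling to cancel one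
  coefficient, shortens its support without killing it.\<close>

lemma QT_simple:
  assumes q: "q \<noteq> 0" "\<forall>k::nat. k > 0 \<longrightarrow> q ^ k \<noteq> 1"
    and J: "J \<subseteq> QT n" "\<And>x y. x \<in> J \<Longrightarrow> y \<in> J \<Longrightarrow> x - y \<in> J"
      "\<And>a x. a \<in> QT n \<Longrightarrow> x \<in> J \<Longrightarrow> qmult q a x \<in> J"
      "\<And>a x. a \<in> QT n \<Longrightarrow> x \<in> J \<Longrightarrow> qmult q x a \<in> J"
    and f: "f \<in> J" "f \<noteq> 0"
  shows "QT n \<subseteq> J"
  using f
proof (induction "card (Poly_Mapping.keys f)" arbitrary: f rule: less_induct)
  case less
  have keys: "Poly_Mapping.keys f \<subseteq> qexps n" using less.prems(1) J(1) by (meson QT_iff subsetD)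
  obtain e where e: "e \<in> Poly_Mapping.keys f" using less.prems(2) by (metis keys_eq_empty ex_in_conv)
  show ?case
  proof (cases "Poly_Mapping.keys f = {e}")
    case True
    define v where "v = Poly_Mapping.lookup f e"
    have v: "v \<noteq> 0" using e by (simp add: v_def in_keys_iff)
    have f_eq: "f = Poly_Mapping.single e v"
      using True by (intro poly_mapping_eqI) (auto simp: v_def lookup_single when_def in_keys_iff)
    define g where "g = Poly_Mapping.single (- e) (q powi (- qsig e e) / v)"
    have g: "g \<in> QT n" using keys e by (auto simp: g_def intro!: QT_single qexps_uminus)
    have "qsig (- e) e = - qsig e e" using qsig_add_left[of e "- e" e] by simp
    then have gf: "qmult q g f = qone"
      using q v by (simp add: f_eq g_def qmult_single_single qscalar_def power_int_minus)
    show ?thesis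
    proof
      fix a assume "a \<in> QT n"
      then have "qmult q (qmult q a g) f \<in> J" using g less.prems by (intro J QT_qmult)
      then show "a \<in> J" by (simp add: qmult_assoc[OF q(1)] gf)
    qed
  next
    case False
    then obtain c where c: "c \<in> Poly_Mapping.keys f" "c \<noteq> e" using e by blast
    obtain b where b: "b \<in> qexps n" "qsig b e - qsig e b \<noteq> qsig b c - qsig c b"
      using commutation_separates[of e n c] e c keys by blast
    let ?m = "Poly_Mapping.single b 1 :: qelem"
    \<comment> \<open>The scalar with m(b) m(e) = t m(e) m(b). The term of f at e thus disappears
      from g, while the one at c survives by the choice of b.\<close>
    define t where "t = q powi (qsig e b - qsig b e)"
    define g where "g = qmult q ?m f - qmult q (qscalar t) (qmult q f ?m)"
    have m: "?m \<in> QT n" using b by (intro QT_single)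
    have gJ: "g \<in> J" unfolding g_def using m less.prems by (intro J) auto
    have lookup_g: "Poly_Mapping.lookup g (b + d) =
        Poly_Mapping.lookup f d * (q powi (- qsig b d) - t * q powi (- qsig d b))" for d
      by (simp add: g_def lookup_minus lookup_qscalar_qmult lookup_single_qmult algebra_simps)
    have "Poly_Mapping.lookup g (b + c) \<noteq> 0"
    proof
      assume "Poly_Mapping.lookup g (b + c) = 0"
      then have eq: "q powi (- qsig b c) = q powi (qsig e b - qsig b e - qsig c b)"
        using c(1) q(1) by (simp add: lookup_g in_keys_iff t_def power_int_add[symmetric])
      have "q powi ((qsig e b - qsig b e - qsig c b) - (- qsig b c)) = 1"
        using q(1) eq by (subst power_int_diff) auto
      then have "(qsig e b - qsig b e - qsig c b) - (- qsig b c) = 0" by (rule powi_eq_1_imp_0[OF q])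
      then show False using b(2) by simp
    qed
    then have "g \<noteq> 0" by auto
    have "Poly_Mapping.keys g \<subseteq> (+) b ` (Poly_Mapping.keys f - {e})"
    proof
      fix d assume d: "d \<in> Poly_Mapping.keys g"
      have d_eq: "d = b + (d - b)" by simp
      have ne: "Poly_Mapping.lookup g (b + (d - b)) \<noteq> 0" using d by (simp add: in_keys_iff)
      have "d - b \<noteq> e"
      proof
        assume "d - b = e"
        have "Poly_Mapping.lookup g (b + e) = 0"
          unfolding lookup_g t_def using q(1) by (simp add: power_int_add[symmetric])
        with ne \<open>d - b = e\<close> show False by simp
      qed
      moreover have "d - b \<in> Poly_Mapping.keys f"
        using ne unfolding lookup_g by (auto simp: in_keys_iff)
      ultimately show "d \<in> (+) b ` (Poly_Mapping.keys f - {e})" using d_eq by blast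
    qed
    then have "card (Poly_Mapping.keys g) \<le> card ((+) b ` (Poly_Mapping.keys f - {e}))"
      by (intro card_mono) auto
    also have "\<dots> \<le> card (Poly_Mapping.keys f - {e})"
      using card_image_le[of "Poly_Mapping.keys f - {e}" "(+) b"] by simp
    also have "\<dots> < card (Poly_Mapping.keys f)" using e by (intro psubset_card_mono) auto
    finally show ?thesis using less.hyps gJ \<open>g \<noteq> 0\<close> by blast
  qed
qed

section \<open>Arithmetic in bimodules\<close>

lemma twisted_simps [simp]:
  "carr (twisted q n \<psi>) = QT n" "addb (twisted q n \<psi>) = (+)" "zerob (twisted q n \<psi>) = 0"
  "negb (twisted q n \<psi>) = uminus" "lact (twisted q n \<psi>) = qmult q"
  "ract (twisted q n \<psi>) = (\<lambda>x a. qmult q x (\<psi> a))"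
  by (simp_all add: twisted_def)

locale qbimod =
  fixes q :: complex and n :: nat and P :: "'p bimod"
  assumes bimod: "is_bimod q n P"
begin

lemma zero_closed [simp]: "zerob P \<in> carr P"
  and add_closed [simp]: "x \<in> carr P \<Longrightarrow> y \<in> carr P \<Longrightarrow> addb P x y \<in> carr P"
  and neg_closed [simp]: "x \<in> carr P \<Longrightarrow> negb P x \<in> carr P"
  and add_assoc: "x \<in> carr P \<Longrightarrow> y \<in> carr P \<Longrightarrow> z \<in> carr P \<Longrightarrow> addb P (addb P x y) z = addb P x (addb P y z)"
  and add_comm: "x \<in> carr P \<Longrightarrow> y \<in> carr P \<Longrightarrow> addb P x y = addb P y x"
  and add_zero_left [simp]: "x \<in> carr P \<Longrightarrow> addb P (zerob P) x = x"
  and add_neg_left [simp]: "x \<in> carr P \<Longrightarrow> addb P (negb P x) x = zerob P"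
  using bimod unfolding is_bimod_def by (metis, metis, metis, metis, metis, metis, metis)

lemma lact_closed [simp]: "a \<in> QT n \<Longrightarrow> x \<in> carr P \<Longrightarrow> lact P a x \<in> carr P"
  and ract_closed [simp]: "a \<in> QT n \<Longrightarrow> x \<in> carr P \<Longrightarrow> ract P x a \<in> carr P"
  and lact_add_right: "a \<in> QT n \<Longrightarrow> x \<in> carr P \<Longrightarrow> y \<in> carr P \<Longrightarrow> lact P a (addb P x y) = addb P (lact P a x) (lact P a y)"
  and ract_add_left: "a \<in> QT n \<Longrightarrow> x \<in> carr P \<Longrightarrow> y \<in> carr P \<Longrightarrow> ract P (addb P x y) a = addb P (ract P x a) (ract P y a)"
  and lact_add_left: "a \<in> QT n \<Longrightarrow> b \<in> QT n \<Longrightarrow> x \<in> carr P \<Longrightarrow> lact P (a + b) x = addb P (lact P a x) (lact P b x)"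
  and ract_add_right: "a \<in> QT n \<Longrightarrow> b \<in> QT n \<Longrightarrow> x \<in> carr P \<Longrightarrow> ract P x (a + b) = addb P (ract P x a) (ract P x b)"
  and lact_qmult: "a \<in> QT n \<Longrightarrow> b \<in> QT n \<Longrightarrow> x \<in> carr P \<Longrightarrow> lact P (qmult q a b) x = lact P a (lact P b x)"
  and ract_qmult: "a \<in> QT n \<Longrightarrow> b \<in> QT n \<Longrightarrow> x \<in> carr P \<Longrightarrow> ract P x (qmult q a b) = ract P (ract P x a) b"
  and ract_lact: "a \<in> QT n \<Longrightarrow> b \<in> QT n \<Longrightarrow> x \<in> carr P \<Longrightarrow> ract P (lact P a x) b = lact P a (ract P x b)"
  and lact_one [simp]: "x \<in> carr P \<Longrightarrow> lact P qone x = x"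
  and ract_one [simp]: "x \<in> carr P \<Longrightarrow> ract P x qone = x"
  and scalar_central: "x \<in> carr P \<Longrightarrow> lact P (qscalar c) x = ract P x (qscalar c)"
  using bimod unfolding is_bimod_def by (meson, meson, meson, meson, meson, meson, meson, meson, meson, meson, meson, meson)

lemma add_zero_right [simp]: "x \<in> carr P \<Longrightarrow> addb P x (zerob P) = x"
  using add_comm[of x "zerob P"] by simp

lemma add_neg_right [simp]: "x \<in> carr P \<Longrightarrow> addb P x (negb P x) = zerob P"
  using add_comm[of x "negb P x"] by simp

lemma add_left_comm: "x \<in> carr P \<Longrightarrow> y \<in> carr P \<Longrightarrow> z \<in> carr P \<Longrightarrow> addb P x (addb P y z) = addb P y (addb P x z)"
  by (metis add_assoc add_comm)

lemma add_neg_cancel_left: "x \<in> carr P \<Longrightarrow> y \<in> carr P \<Longrightarrow> addb P (negb P x) (addb P x y) = y"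
  by (simp add: add_assoc[symmetric])

lemma add_neg_cancel_right: "x \<in> carr P \<Longrightarrow> y \<in> carr P \<Longrightarrow> addb P x (addb P (negb P x) y) = y"
  by (simp add: add_assoc[symmetric])

lemma add_self_imp_zero: "x \<in> carr P \<Longrightarrow> addb P x x = x \<Longrightarrow> x = zerob P"
  by (metis add_neg_cancel_left add_neg_left)

lemma neg_unique: "x \<in> carr P \<Longrightarrow> y \<in> carr P \<Longrightarrow> addb P x y = zerob P \<Longrightarrow> y = negb P x"
  by (metis add_neg_cancel_left add_zero_right neg_closed)

lemma eq_if_neg_add_zero: "x \<in> carr P \<Longrightarrow> y \<in> carr P \<Longrightarrow> addb P (negb P x) y = zerob P \<Longrightarrow> x = y"
  by (metis add_neg_cancel_right add_zero_right)

lemma lact_zero_left [simp]: "x \<in> carr P \<Longrightarrow> lact P 0 x = zerob P"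
  using lact_add_left[of 0 0 x] by (intro add_self_imp_zero) auto

lemma ract_zero_right [simp]: "x \<in> carr P \<Longrightarrow> ract P x 0 = zerob P"
  using ract_add_right[of 0 0 x] by (intro add_self_imp_zero) auto

lemma lact_uminus: "a \<in> QT n \<Longrightarrow> x \<in> carr P \<Longrightarrow> lact P (- a) x = negb P (lact P a x)"
  using lact_add_left[of a "- a" x] by (intro neg_unique) (auto simp: QT_uminus)

lemma ract_uminus: "a \<in> QT n \<Longrightarrow> x \<in> carr P \<Longrightarrow> ract P x (- a) = negb P (ract P x a)"
  using ract_add_right[of a "- a" x] by (intro neg_unique) (auto simp: QT_uminus)

lemma neg_zero [simp]: "negb P (zerob P) = zerob P"
  using neg_unique[of "zerob P" "zerob P"] by simp

lemma neg_add: "x \<in> carr P \<Longrightarrow> y \<in> carr P \<Longrightarrow> negb P (addb P x y) = addb P (negb P x) (negb P y)"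
  by (rule neg_unique[symmetric]) (simp_all add: add_assoc add_left_comm[of y] add_neg_cancel_right)

end

section \<open>Signed words and the relations of the tensor product\<close>

definition word_over :: "'a set \<Rightarrow> 'b set \<Rightarrow> (('a \<times> 'b) \<times> bool) list \<Rightarrow> bool" where
  "word_over X Y w \<longleftrightarrow> (\<forall>((x, y), s)\<in>set w. x \<in> X \<and> y \<in> Y)"

lemma word_over_simps [simp]:
  "word_over X Y []"
  "word_over X Y (((x, y), s) # w) \<longleftrightarrow> x \<in> X \<and> y \<in> Y \<and> word_over X Y w"
  "word_over X Y (u @ v) \<longleftrightarrow> word_over X Y u \<and> word_over X Y v"
  by (simp_all add: word_over_def ball_Un)

lemma word_eval_in:
  assumes "zerob P \<in> H" "\<And>a b. a \<in> H \<Longrightarrow> b \<in> H \<Longrightarrow> addb P a b \<in> H" "\<And>a. a \<in> H \<Longrightarrow> negb P a \<in> H"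
    and "\<forall>x\<in>X. \<forall>y\<in>Y. \<gamma> x y \<in> H" and "word_over X Y w"
  shows "word_eval P \<gamma> w \<in> H"
  using assms(5)
proof (induction w)
  case (Cons p w)
  obtain x y s where "p = ((x, y), s)" by (metis prod.exhaust)
  then show ?case using Cons assms(1-4) by simp
qed (simp add: assms(1))

lemma word_eval_hom:
  assumes P: "is_bimod q n P" and P': "is_bimod q n P'"
    and f: "\<And>a. a \<in> carr P \<Longrightarrow> f a \<in> carr P'" "\<And>a b. a \<in> carr P \<Longrightarrow> b \<in> carr P \<Longrightarrow> f (addb P a b) = addb P' (f a) (f b)"
    and \<gamma>: "\<forall>x\<in>X. \<forall>y\<in>Y. \<gamma> x y \<in> carr P" and w: "word_over X Y w"
  shows "f (word_eval P \<gamma> w) = word_eval P' (\<lambda>x y. f (\<gamma> x y)) w"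
proof -
  interpret P: qbimod q n P by unfold_locales (rule P)
  interpret P': qbimod q n P' by unfold_locales (rule P')
  have zero: "f (zerob P) = zerob P'"
    using f(2)[of "zerob P" "zerob P"] f(1) by (intro P'.add_self_imp_zero) auto
  have neg: "f (negb P a) = negb P' (f a)" if "a \<in> carr P" for a
    using f(2)[of a "negb P a"] f(1) that zero by (intro P'.neg_unique) auto
  have closed: "word_eval P \<gamma> v \<in> carr P" if "word_over X Y v" for v
    using that by (intro word_eval_in[of P _ X Y]) (auto simp: \<gamma>)
  show ?thesis using w
  proof (induction w)
    case (Cons p w)
    then show ?case by (cases p rule: prod.exhaust, cases "fst p") (auto simp: f neg \<gamma> closed)
  qed (simp add: zero)
qed

lemma word_eval_map:
  "word_eval P \<gamma> (map (\<lambda>((x, y), s). ((g x, h y), s)) w) = word_eval P (\<lambda>x y. \<gamma> (g x) (h y)) w"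
  by (induction P "\<lambda>x y. \<gamma> (g x) (h y)" w rule: word_eval.induct) auto

lemma word_over_map:
  "word_over X Y w \<Longrightarrow> (\<And>x. x \<in> X \<Longrightarrow> g x \<in> X') \<Longrightarrow> (\<And>y. y \<in> Y \<Longrightarrow> h y \<in> Y')
    \<Longrightarrow> word_over X' Y' (map (\<lambda>((x, y), s). ((g x, h y), s)) w)"
  by (fastforce simp: word_over_def)

lemma word_eval_cong:
  "word_over X Y w \<Longrightarrow> (\<And>x y. x \<in> X \<Longrightarrow> y \<in> Y \<Longrightarrow> \<gamma> x y = \<gamma>' x y) \<Longrightarrow> word_eval P \<gamma> w = word_eval P \<gamma>' w"
  by (induction w) auto

lemma content_append: "content (u @ v) = content u + content v"
  by (induction u rule: content.induct) (auto simp: add.assoc)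

text \<open>Letters p of a single sign cannot cancel in the coefficient at p. Used contrapositively,
  to find a letter that cancels a given one.\<close>

lemma content_sign:
  "(p, \<not> s) \<notin> set w \<Longrightarrow> (if s then content w p \<ge> 0 else content w p \<le> 0)"
  by (induction w rule: content.induct) (auto simp: delta_def split: if_splits)

context qbimod
begin

lemma word_eval_closed:
  "\<forall>x\<in>X. \<forall>y\<in>Y. \<gamma> x y \<in> carr P \<Longrightarrow> word_over X Y w \<Longrightarrow> word_eval P \<gamma> w \<in> carr P"
  by (rule word_eval_in[of P _ X Y]) auto

lemma word_eval_append:
  assumes \<gamma>: "\<forall>x\<in>X. \<forall>y\<in>Y. \<gamma> x y \<in> carr P" and "word_over X Y u" "word_over X Y v"
  shows "word_eval P \<gamma> (u @ v) = addb P (word_eval P \<gamma> u) (word_eval P \<gamma> v)"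
  using assms(2)
proof (induction u)
  case (Cons p u)
  obtain x y s where "p = ((x, y), s)" by (metis prod.exhaust)
  then show ?case using Cons assms(3) by (simp add: \<gamma> add_assoc word_eval_closed[OF \<gamma>])
qed (use assms(3) in \<open>simp add: word_eval_closed[OF \<gamma>]\<close>)

text \<open>A word that vanishes in the free abelian group cancels formally: its first letter occurs
  again with the opposite sign, both can be deleted since addition is commutative, and the rest is
  shorter.\<close>

lemma word_eval_content_zero:
  assumes \<gamma>: "\<forall>x\<in>X. \<forall>y\<in>Y. \<gamma> x y \<in> carr P" and "word_over X Y w" "content w = 0"
  shows "word_eval P \<gamma> w = zerob P"
  using assms(2,3)
proof (induction w rule: length_induct)
  case (1 w)
  show ?case
  proof (cases w)
    case (Cons p w')
    obtain x y s where p: "p = ((x, y), s)" by (metis prod.exhaust)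
    have w': "word_over X Y w'" "x \<in> X" "y \<in> Y" using 1 Cons p by auto
    have "(if s then delta (x, y) else - delta (x, y)) (x, y) + content w' (x, y) = 0"
      using fun_cong[OF 1(3), of "(x, y)"] by (simp add: Cons p)
    then have "((x, y), \<not> s) \<in> set w'"
      using content_sign[of "(x, y)" s w'] by (auto simp: delta_def split: if_splits)
    then obtain u v where uv: "w' = u @ ((x, y), \<not> s) # v" by (meson split_list)
    have over: "word_over X Y u" "word_over X Y v" using w' uv by auto
    have "content (u @ v) = content w"
      by (cases s) (simp_all add: Cons p uv content_append algebra_simps)
    then have content: "content (u @ v) = 0" using 1(3) by (rule trans)
    have "length (u @ v) < length w" by (simp add: Cons uv)
    then have "word_eval P \<gamma> (u @ v) = zerob P"
      using 1(1) over content by (metis word_over_simps(3))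
    then have *: "addb P (word_eval P \<gamma> u) (word_eval P \<gamma> v) = zerob P"
      by (simp add: word_eval_append[OF \<gamma> over])
    have "word_eval P \<gamma> w' = addb P (word_eval P \<gamma> u) (word_eval P \<gamma> (((x, y), \<not> s) # v))"
      unfolding uv by (rule word_eval_append[OF \<gamma>]) (use over w' in auto)
    then show ?thesis
      using * word_eval_closed[OF \<gamma> over(1)] word_eval_closed[OF \<gamma> over(2)] \<gamma> w'(2,3)
      by (cases s) (simp_all add: Cons p add_left_comm[of "word_eval P \<gamma> u"] add_neg_cancel_right add_neg_cancel_left)
  qed simp
qed

end

text \<open>Maps that factor through the tensor product as an abelian group. The outer actions of
  \<open>balanced_bimap\<close> are left aside because the auxiliary maps below, such as
  \<open>ract M x (\<beta>' y z)\<close> in x and y, are not compatible with both of them.\<close>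

definition middle_linear :: "nat \<Rightarrow> 'a bimod \<Rightarrow> 'b bimod \<Rightarrow> 'p bimod \<Rightarrow> ('a \<Rightarrow> 'b \<Rightarrow> 'p) \<Rightarrow> bool" where
  "middle_linear n M N P \<gamma> \<longleftrightarrow>
     (\<forall>x\<in>carr M. \<forall>y\<in>carr N. \<gamma> x y \<in> carr P) \<and>
     (\<forall>x\<in>carr M. \<forall>x'\<in>carr M. \<forall>y\<in>carr N. \<gamma> (addb M x x') y = addb P (\<gamma> x y) (\<gamma> x' y)) \<and>
     (\<forall>x\<in>carr M. \<forall>y\<in>carr N. \<forall>y'\<in>carr N. \<gamma> x (addb N y y') = addb P (\<gamma> x y) (\<gamma> x y')) \<and>
     (\<forall>a\<in>QT n. \<forall>x\<in>carr M. \<forall>y\<in>carr N. \<gamma> (ract M x a) y = \<gamma> x (lact N a y))"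

text \<open>The three kinds of generators mirror the three identities of a middle linear map, so the
  evident words of two or three letters evaluate to zero. Both signs are provided since
  \<open>tensor_rel\<close> adds and subtracts generators.\<close>

lemma tensor_gen_words:
  assumes M: "is_bimod q n M" and N: "is_bimod q n N" and P: "is_bimod q n P"
    and \<gamma>: "middle_linear n M N P \<gamma>" and g: "g \<in> tensor_gens n M N"
  shows "\<exists>u v. word_over (carr M) (carr N) u \<and> content u = g \<and> word_eval P \<gamma> u = zerob P \<and>
     word_over (carr M) (carr N) v \<and> content v = - g \<and> word_eval P \<gamma> v = zerob P"
proof -
  interpret M: qbimod q n M by unfold_locales (rule M)
  interpret N: qbimod q n N by unfold_locales (rule N)
  interpret P: qbimod q n P by unfold_locales (rule P)
  have closed: "\<forall>x\<in>carr M. \<forall>y\<in>carr N. \<gamma> x y \<in> carr P"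
    using \<gamma> by (simp add: middle_linear_def)
  note cancel = P.neg_add P.add_assoc P.add_left_comm P.add_neg_cancel_left P.add_neg_cancel_right
  from g consider
    (left) x x' y where "x \<in> carr M" "x' \<in> carr M" "y \<in> carr N" "g = delta (addb M x x', y) - delta (x, y) - delta (x', y)"
  | (right) x y y' where "x \<in> carr M" "y \<in> carr N" "y' \<in> carr N" "g = delta (x, addb N y y') - delta (x, y) - delta (x, y')"
  | (mid) x a y where "x \<in> carr M" "a \<in> QT n" "y \<in> carr N" "g = delta (ract M x a, y) - delta (x, lact N a y)"
    unfolding tensor_gens_def by blast
  then show ?thesis
  proof cases
    case left
    have "\<gamma> (addb M x x') y = addb P (\<gamma> x y) (\<gamma> x' y)" using \<gamma> left by (simp add: middle_linear_def)
    then show ?thesis using left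
      by (intro exI[of _ "[((addb M x x', y), True), ((x, y), False), ((x', y), False)]"]
          exI[of _ "[((addb M x x', y), False), ((x, y), True), ((x', y), True)]"])
        (simp add: closed cancel algebra_simps)
  next
    case right
    have "\<gamma> x (addb N y y') = addb P (\<gamma> x y) (\<gamma> x y')" using \<gamma> right by (simp add: middle_linear_def)
    then show ?thesis using right
      by (intro exI[of _ "[((x, addb N y y'), True), ((x, y), False), ((x, y'), False)]"]
          exI[of _ "[((x, addb N y y'), False), ((x, y), True), ((x, y'), True)]"])
        (simp add: closed cancel algebra_simps)
  next
    case mid
    have "\<gamma> (ract M x a) y = \<gamma> x (lact N a y)" using \<gamma> mid by (simp add: middle_linear_def)
    then show ?thesis using mid
      by (intro exI[of _ "[((ract M x a, y), True), ((x, lact N a y), False)]"]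
          exI[of _ "[((ract M x a, y), False), ((x, lact N a y), True)]"])
        (simp add: closed cancel algebra_simps)
  qed
qed

text \<open>Appending to w a word that evaluates to zero and removes the last generator from the
  content leaves the value unchanged; repeating this leads to content 0.\<close>

lemma word_eval_tensor_rel:
  assumes M: "is_bimod q n M" and N: "is_bimod q n N" and P: "is_bimod q n P"
    and \<gamma>: "middle_linear n M N P \<gamma>" and r: "r \<in> tensor_rel n M N"
  shows "word_over (carr M) (carr N) w \<Longrightarrow> content w = r \<Longrightarrow> word_eval P \<gamma> w = zerob P"
proof -
  interpret P: qbimod q n P by unfold_locales (rule P)
  have closed: "\<forall>x\<in>carr M. \<forall>y\<in>carr N. \<gamma> x y \<in> carr P"
    using \<gamma> by (simp add: middle_linear_def)
  have cancel: "word_eval P \<gamma> w = zerob P"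
    if "word_over (carr M) (carr N) w" "word_over (carr M) (carr N) u" "word_eval P \<gamma> u = zerob P"
      "word_eval P \<gamma> (w @ u) = zerob P" for w u
  proof -
    have "addb P (word_eval P \<gamma> w) (zerob P) = zerob P"
      using P.word_eval_append[OF closed that(1,2)] unfolding that(3,4) by (rule sym)
    then show ?thesis
      using P.add_zero_right[OF P.word_eval_closed[OF closed that(1)]] by (simp only:)
  qed
  show "word_over (carr M) (carr N) w \<Longrightarrow> content w = r \<Longrightarrow> word_eval P \<gamma> w = zerob P" for w
    using r
  proof (induction arbitrary: w rule: tensor_rel.induct)
    case zero
    then show ?case using P.word_eval_content_zero[OF closed] by blast
  next
    case (add r g)
    obtain v where v: "word_over (carr M) (carr N) v" "content v = - g" "word_eval P \<gamma> v = zerob P"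
      using tensor_gen_words[OF M N P \<gamma> add.hyps(2)] by blast
    then have "word_eval P \<gamma> (w @ v) = zerob P"
      using add.prems by (intro add.IH) (simp_all add: content_append)
    then show ?case using cancel add.prems v by blast
  next
    case (sub r g)
    obtain v where v: "word_over (carr M) (carr N) v" "content v = g" "word_eval P \<gamma> v = zerob P"
      using tensor_gen_words[OF M N P \<gamma> sub.hyps(2)] by blast
    then have "word_eval P \<gamma> (w @ v) = zerob P"
      using sub.prems by (intro sub.IH) (simp_all add: content_append)
    then show ?case using cancel sub.prems v by blast
  qed
qed

section \<open>Invertible bimodules\<close>

text \<open>The body of \<open>tensor_iso\<close> with the pairing as a parameter, so that a locale
  can fix it.\<close>

definition tensor_map :: "complex \<Rightarrow> nat \<Rightarrow> 'a bimod \<Rightarrow> 'b bimod \<Rightarrow> 'p bimod \<Rightarrow> ('a \<Rightarrow> 'b \<Rightarrow> 'p) \<Rightarrow> bool" where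
  "tensor_map q n M N P \<beta> \<longleftrightarrow> balanced_bimap q n M N P \<beta> \<and>
     (\<forall>v\<in>carr P. \<exists>w. word_over (carr M) (carr N) w \<and> word_eval P \<beta> w = v) \<and>
     (\<forall>w. word_over (carr M) (carr N) w \<and> word_eval P \<beta> w = zerob P \<longrightarrow> content w \<in> tensor_rel n M N)"

lemma tensor_iso_iff: "tensor_iso q n M N P \<longleftrightarrow> (\<exists>\<beta>. tensor_map q n M N P \<beta>)"
  by (simp add: tensor_iso_def tensor_map_def word_over_def)

lemma qaut_id: "qaut q n id"
  by (simp add: qaut_def)

lemma qaut_closed: "qaut q n \<psi> \<Longrightarrow> a \<in> QT n \<Longrightarrow> \<psi> a \<in> QT n"
  by (auto simp: qaut_def bij_betw_def)

lemma is_bimod_twisted: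
  assumes "q \<noteq> 0" "qaut q n \<psi>"
  shows "is_bimod q n (twisted q n \<psi>)"
proof -
  have scalar: "\<psi> (qscalar c) = qscalar c" for c
    using assms(2) unfolding qaut_def by (metis QT_qscalar qmult_one(2))
  have hom: "\<psi> (a + b) = \<psi> a + \<psi> b" "\<psi> (qmult q a b) = qmult q (\<psi> a) (\<psi> b)"
    if "a \<in> QT n" "b \<in> QT n" for a b
    using assms(2) that by (auto simp: qaut_def)
  show ?thesis
    unfolding is_bimod_def
    by (auto simp: scalar hom qaut_closed[OF assms(2)] QT_add QT_uminus QT_qmult qmult_add_left
        qmult_add_right qmult_assoc[OF assms(1)] qscalar_commute add.assoc add.commute)
qed

text \<open>The law \<beta>(x,y) z = x \<beta>'(y,z) of a Morita context is not among the
  assumptions: the two pairings come from unrelated isomorphisms.\<close>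

locale morita =
  fixes q :: complex and n :: nat and M :: "'a bimod" and N :: "'b bimod"
    and \<beta> :: "'a \<Rightarrow> 'b \<Rightarrow> qelem" and \<beta>' :: "'b \<Rightarrow> 'a \<Rightarrow> qelem"
  assumes q_nonzero: "q \<noteq> 0"
    and not_root: "\<forall>k::nat. k > 0 \<longrightarrow> q ^ k \<noteq> 1"
    and bimod_M: "is_bimod q n M" and bimod_N: "is_bimod q n N"
    and tensor_MN: "tensor_map q n M N (twisted q n id) \<beta>"
    and tensor_NM: "tensor_map q n N M (twisted q n id) \<beta>'"
begin

sublocale M: qbimod q n M by unfold_locales (rule bimod_M)
sublocale N: qbimod q n N by unfold_locales (rule bimod_N)
sublocale A: qbimod q n "twisted q n id"
  by unfold_locales (rule is_bimod_twisted[OF q_nonzero qaut_id])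

lemma morita_sym: "morita q n N M \<beta>' \<beta>"
  by unfold_locales (rule q_nonzero not_root bimod_M bimod_N tensor_MN tensor_NM)+

lemma \<beta>_closed [simp]: "x \<in> carr M \<Longrightarrow> y \<in> carr N \<Longrightarrow> \<beta> x y \<in> QT n"
  and \<beta>_add_left: "x \<in> carr M \<Longrightarrow> x' \<in> carr M \<Longrightarrow> y \<in> carr N \<Longrightarrow> \<beta> (addb M x x') y = \<beta> x y + \<beta> x' y"
  and \<beta>_add_right: "x \<in> carr M \<Longrightarrow> y \<in> carr N \<Longrightarrow> y' \<in> carr N \<Longrightarrow> \<beta> x (addb N y y') = \<beta> x y + \<beta> x y'"
  and \<beta>_middle: "a \<in> QT n \<Longrightarrow> x \<in> carr M \<Longrightarrow> y \<in> carr N \<Longrightarrow> \<beta> (ract M x a) y = \<beta> x (lact N a y)"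
  and \<beta>_lact: "a \<in> QT n \<Longrightarrow> x \<in> carr M \<Longrightarrow> y \<in> carr N \<Longrightarrow> \<beta> (lact M a x) y = qmult q a (\<beta> x y)"
  and \<beta>_ract: "a \<in> QT n \<Longrightarrow> x \<in> carr M \<Longrightarrow> y \<in> carr N \<Longrightarrow> \<beta> x (ract N y a) = qmult q (\<beta> x y) a"
  using tensor_MN unfolding tensor_map_def balanced_bimap_def by auto

lemma word_eval_\<beta>_closed: "word_over (carr M) (carr N) w \<Longrightarrow> word_eval (twisted q n id) \<beta> w \<in> QT n"
  using A.word_eval_closed[of "carr M" "carr N" \<beta> w] by simp

lemma \<beta>_surj:
  assumes "a \<in> QT n"
  obtains w where "word_over (carr M) (carr N) w" "word_eval (twisted q n id) \<beta> w = a"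
proof -
  have "\<forall>v\<in>QT n. \<exists>w. word_over (carr M) (carr N) w \<and> word_eval (twisted q n id) \<beta> w = v"
    using tensor_MN unfolding tensor_map_def twisted_simps by (elim conjE)
  from bspec[OF this assms] show thesis by (elim exE conjE) (rule that)
qed

lemma span:
  assumes "0 \<in> H" "\<And>a b. a \<in> H \<Longrightarrow> b \<in> H \<Longrightarrow> a + b \<in> H" "\<And>a. a \<in> H \<Longrightarrow> - a \<in> H"
    and "\<And>x y. x \<in> carr M \<Longrightarrow> y \<in> carr N \<Longrightarrow> \<beta> x y \<in> H"
  shows "QT n \<subseteq> H"
proof
  fix a assume "a \<in> QT n"
  then obtain w where "word_over (carr M) (carr N) w" "word_eval (twisted q n id) \<beta> w = a" by (rule \<beta>_surj)
  then show "a \<in> H" using word_eval_in[of "twisted q n id" H "carr M" "carr N" \<beta> w] assms by simp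
qed

text \<open>The universal property of \<open>M \<otimes> N\<close>, identified with the algebra through \<open>\<beta>\<close>.\<close>

lemma middle_linear_factors:
  assumes P: "is_bimod q n P" and \<gamma>: "middle_linear n M N P \<gamma>"
    and "x \<in> carr M" "y \<in> carr N" "word_over (carr M) (carr N) v"
    and eq: "\<beta> x y = word_eval (twisted q n id) \<beta> v"
  shows "\<gamma> x y = word_eval P \<gamma> v"
proof -
  interpret P: qbimod q n P by unfold_locales (rule P)
  let ?w = "((x, y), False) # v"
  have over: "word_over (carr M) (carr N) ?w" using assms by simp
  moreover have "word_eval (twisted q n id) \<beta> ?w = zerob (twisted q n id)" using eq by simp
  ultimately have "content ?w \<in> tensor_rel n M N" using tensor_MN unfolding tensor_map_def by blast
  then have "word_eval P \<gamma> ?w = zerob P"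
    by (rule word_eval_tensor_rel[OF bimod_M bimod_N P \<gamma> _ over refl])
  then have sum: "addb P (negb P (\<gamma> x y)) (word_eval P \<gamma> v) = zerob P" by simp
  have \<gamma>_closed: "\<forall>x\<in>carr M. \<forall>y\<in>carr N. \<gamma> x y \<in> carr P" using \<gamma> by (simp add: middle_linear_def)
  then have "\<gamma> x y \<in> carr P" using assms(3,4) by blast
  then show ?thesis
    using sum by (rule P.eq_if_neg_add_zero[OF _ P.word_eval_closed[OF \<gamma>_closed assms(5)]])
qed

text \<open>The case of the empty word: \<beta>(x,y) = 0 says that x \<otimes> y = 0.\<close>

lemma middle_linear_zero:
  assumes "is_bimod q n P" "middle_linear n M N P \<gamma>" "x \<in> carr M" "y \<in> carr N" "\<beta> x y = 0"
  shows "\<gamma> x y = zerob P"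
  using middle_linear_factors[OF assms(1-4), of "[]"] assms(5) by simp

lemma \<beta>_zero_left [simp]: "y \<in> carr N \<Longrightarrow> \<beta> (zerob M) y = 0"
  using \<beta>_add_left[of "zerob M" "zerob M" y] by simp

lemma \<beta>_zero_right [simp]: "x \<in> carr M \<Longrightarrow> \<beta> x (zerob N) = 0"
  using \<beta>_add_right[of x "zerob N" "zerob N"] by simp

lemma \<beta>_neg_left: "x \<in> carr M \<Longrightarrow> y \<in> carr N \<Longrightarrow> \<beta> (negb M x) y = - \<beta> x y"
  using \<beta>_add_left[of "negb M x" x y] by (simp add: eq_neg_iff_add_eq_0)

lemma \<beta>_neg_right: "x \<in> carr M \<Longrightarrow> y \<in> carr N \<Longrightarrow> \<beta> x (negb N y) = - \<beta> x y"
  using \<beta>_add_right[of x "negb N y" y] by (simp add: eq_neg_iff_add_eq_0)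

lemma \<beta>_nontrivial: obtains x y where "x \<in> carr M" "y \<in> carr N" "\<beta> x y \<noteq> 0"
proof -
  have "\<not> QT n \<subseteq> {0}" using QT_qscalar[of 1 n] by (auto simp: qscalar_def)
  then show thesis using span[of "{0}"] that by auto
qed

end

section \<open>Nondegeneracy of the pairings\<close>

context morita
begin

interpretation sym: morita q n N M \<beta>' \<beta> by (rule morita_sym)

text \<open>The expression x \<beta>'(y,z) is middle linear in x and y, so it vanishes together with
  \<beta>(x,y). The values of \<beta>' span the algebra, hence x is killed by 1.\<close>

lemma \<beta>_nondegenerate_left:
  assumes x: "x \<in> carr M" and zero: "\<And>y. y \<in> carr N \<Longrightarrow> \<beta> x y = 0"
  shows "x = zerob M"
proof -
  have "ract M x (\<beta>' y z) = zerob M" if "y \<in> carr N" "z \<in> carr M" for y z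
  proof -
    have "middle_linear n M N M (\<lambda>x y. ract M x (\<beta>' y z))"
      using that(2) by (simp add: middle_linear_def M.ract_add_left M.ract_add_right sym.\<beta>_add_left
          sym.\<beta>_lact M.ract_qmult)
    then show ?thesis using middle_linear_zero[OF bimod_M] x that(1) zero by blast
  qed
  then have "QT n \<subseteq> {a \<in> QT n. ract M x a = zerob M}"
    using x by (intro sym.span) (auto simp: M.ract_add_right M.ract_uminus QT_add QT_uminus)
  then have "ract M x qone = zerob M" using QT_qscalar by blast
  then show ?thesis using x by simp
qed

text \<open>The mirror image, with the expression \<beta>'(z,x) y.\<close>

lemma \<beta>_nondegenerate_right:
  assumes y: "y \<in> carr N" and zero: "\<And>x. x \<in> carr M \<Longrightarrow> \<beta> x y = 0"
  shows "y = zerob N"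
proof -
  have "lact N (\<beta>' z x) y = zerob N" if "x \<in> carr M" "z \<in> carr N" for x z
  proof -
    have "middle_linear n M N N (\<lambda>x y. lact N (\<beta>' z x) y)"
      using that(2) by (simp add: middle_linear_def N.lact_add_left N.lact_add_right sym.\<beta>_add_right
          sym.\<beta>_ract N.lact_qmult)
    then show ?thesis using middle_linear_zero[OF bimod_N] y that(1) zero by blast
  qed
  then have "QT n \<subseteq> {a \<in> QT n. lact N a y = zerob N}"
    using y by (intro sym.span) (auto simp: N.lact_add_left N.lact_uminus QT_add QT_uminus)
  then have "lact N qone y = zerob N" using QT_qscalar by blast
  then show ?thesis using y by simp
qed

end

section \<open>Torsion-freeness, the eigenvector and freeness of rank one\<close>

context morita
begin

interpretation sym: morita q n N M \<beta>' \<beta> by (rule morita_sym)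

text \<open>The product \<beta>'(z,x) \<beta>'(y,z') is middle linear in x and y, so it vanishes
  with \<beta>(x,y). The algebra is a domain, so one factor vanishes for each z and z', and
  nondegeneracy of \<beta>' gives the claim.\<close>

lemma \<beta>_no_zero_divisors:
  assumes x: "x \<in> carr M" and y: "y \<in> carr N" and zero: "\<beta> x y = 0"
  shows "x = zerob M \<or> y = zerob N"
proof -
  have "\<beta>' z x = 0 \<or> \<beta>' y z' = 0" if "z \<in> carr N" "z' \<in> carr M" for z z'
  proof -
    have "middle_linear n M N (twisted q n id) (\<lambda>x y. qmult q (\<beta>' z x) (\<beta>' y z'))"
      using that by (simp add: middle_linear_def QT_qmult qmult_add_left qmult_add_right
          sym.\<beta>_add_left sym.\<beta>_add_right sym.\<beta>_lact sym.\<beta>_ract qmult_assoc[OF q_nonzero])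
    then have "qmult q (\<beta>' z x) (\<beta>' y z') = 0"
      using middle_linear_zero[OF A.bimod] x y zero by fastforce
    then show ?thesis by (simp add: qmult_eq_0_iff q_nonzero)
  qed
  then show ?thesis
    using sym.\<beta>_nondegenerate_left[OF y] sym.\<beta>_nondegenerate_right[OF x] by blast
qed

lemma ract_torsion_free:
  assumes "x \<in> carr M" "a \<in> QT n" "ract M x a = zerob M"
  shows "x = zerob M \<or> a = 0"
proof (rule disjCI)
  assume a: "a \<noteq> 0"
  have "\<beta>' y x = 0" if "y \<in> carr N" for y
    using sym.\<beta>_ract[of a y x] assms that a qmult_eq_0_iff[OF q_nonzero] by simp
  then show "x = zerob M" using sym.\<beta>_nondegenerate_right assms(1) by blast
qed

lemma lact_torsion_free:
  assumes "x \<in> carr M" "a \<in> QT n" "lact M a x = zerob M"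
  shows "x = zerob M \<or> a = 0"
proof (rule disjCI)
  assume a: "a \<noteq> 0"
  have "\<beta> x y = 0" if "y \<in> carr N" for y
    using \<beta>_lact[of a x y] assms that a qmult_eq_0_iff[OF q_nonzero] by simp
  then show "x = zerob M" using \<beta>_nondegenerate_left assms(1) by blast
qed

lemma lact_cancel:
  assumes "x \<in> carr M" "x \<noteq> zerob M" "a \<in> QT n" "b \<in> QT n" "lact M a x = lact M b x"
  shows "a = b"
proof -
  have "lact M (a - b) x = zerob M"
    using M.lact_add_left[of a "- b" x] assms by (simp add: QT_uminus M.lact_uminus)
  then show ?thesis using lact_torsion_free[of x "a - b"] assms by (simp add: QT_diff)
qed

lemma ract_cancel:
  assumes "x \<in> carr M" "x \<noteq> zerob M" "a \<in> QT n" "b \<in> QT n" "ract M x a = ract M x b"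
  shows "a = b"
proof -
  have "ract M x (a - b) = zerob M"
    using M.ract_add_right[of a "- b" x] assms by (simp add: QT_uminus M.ract_uminus)
  then show ?thesis using ract_torsion_free[of x "a - b"] assms by (simp add: QT_diff)
qed

text \<open>One x0 has to serve all monomials, since only then does the relation extend to their
  linear combinations; scalars move from the right to the left because they act centrally.\<close>

lemma eigenvector:
  obtains x0 where "x0 \<in> carr M" "x0 \<noteq> zerob M"
    "\<And>a. a \<in> QT n \<Longrightarrow> \<exists>d\<in>QT n. ract M x0 a = lact M d x0"
proof -
  obtain x1 y0 where x1: "x1 \<in> carr M" and y0: "y0 \<in> carr N" and nz: "\<beta> x1 y0 \<noteq> 0" by (rule \<beta>_nontrivial)
  define \<iota> where "\<iota> x = \<beta> x y0" for x
  define I where "I = \<iota> ` carr M"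
  have y0_nz: "y0 \<noteq> zerob N" using nz x1 by auto
  have \<iota>_inj: "inj_on \<iota> (carr M)"
  proof (rule inj_onI)
    fix x z assume xz: "x \<in> carr M" "z \<in> carr M" "\<iota> x = \<iota> z"
    have "\<beta> (addb M (negb M x) z) y0 = 0"
      using xz y0 by (simp add: \<iota>_def \<beta>_add_left \<beta>_neg_left)
    then have "addb M (negb M x) z = zerob M"
      using \<beta>_no_zero_divisors[OF _ y0] y0_nz xz by simp
    then show "x = z" by (rule M.eq_if_neg_add_zero[OF xz(1,2)])
  qed
  have \<iota>_lact: "\<iota> (lact M a x) = qmult q a (\<iota> x)" if "a \<in> QT n" "x \<in> carr M" for a x
    using that y0 by (simp add: \<iota>_def \<beta>_lact)
  interpret qleft_ideal q n I
  proof
    show "I \<subseteq> QT n" using y0 by (auto simp: I_def \<iota>_def)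
    show "x - y \<in> I" if "x \<in> I" "y \<in> I" for x y
    proof -
      obtain u v where "u \<in> carr M" "v \<in> carr M" "x = \<iota> u" "y = \<iota> v"
        using \<open>x \<in> I\<close> \<open>y \<in> I\<close> unfolding I_def by blast
      then have "x - y = \<iota> (addb M u (negb M v))" "addb M u (negb M v) \<in> carr M"
        using y0 by (simp_all add: \<iota>_def \<beta>_add_left \<beta>_neg_left)
      then show ?thesis by (auto simp: I_def)
    qed
    show "qmult q a x \<in> I" if "a \<in> QT n" "x \<in> I" for a x
    proof -
      obtain u where "u \<in> carr M" "x = \<iota> u" using \<open>x \<in> I\<close> unfolding I_def by blast
      then show ?thesis using \<iota>_lact[of a u] that(1) by (auto simp: I_def intro!: image_eqI[of _ _ "lact M a u"])
    qed
  qed (rule q_nonzero)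
  \<comment> \<open>The right action of a on M, transported to the ideal along the embedding
    \<iota>.\<close>
  define \<rho> where "\<rho> a f = \<iota> (ract M (inv_into (carr M) \<iota> f) a)" for a f
  have \<rho>: "\<rho> a (\<iota> x) = \<iota> (ract M x a)" if "x \<in> carr M" for a x
    using that \<iota>_inj by (simp add: \<rho>_def)
  have aut: "ideal_aut (\<rho> a) (\<rho> b)"
    if ab: "a \<in> QT n" "b \<in> QT n" "qmult q a b = qone" "qmult q b a = qone" for a b
  proof -
    have inv: "ract M (ract M x a) b = x \<and> ract M (ract M x b) a = x" if "x \<in> carr M" for x
      using M.ract_qmult[of a b x] M.ract_qmult[of b a x] that ab by simp
    show ?thesis
      unfolding ideal_aut_def unfolding I_def
      by (auto simp: \<rho> inv ab \<iota>_lact[symmetric] M.ract_lact)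
  qed
  have "\<iota> x1 \<in> I" "\<iota> x1 \<noteq> 0" using x1 nz by (auto simp: I_def \<iota>_def)
  then obtain f where f: "f \<in> I" "f \<noteq> 0" "\<And>R R'. ideal_aut R R' \<Longrightarrow> \<exists>V\<in>QT n. R f = qmult q V f"
    by (rule common_eigenvector) (rule that)
  then obtain x0 where x0: "x0 \<in> carr M" "f = \<iota> x0" by (auto simp: I_def)
  have "x0 \<noteq> zerob M" using f(2) x0 y0 by (auto simp: \<iota>_def)
  have monomial: "\<exists>d\<in>QT n. ract M x0 (Poly_Mapping.single e 1) = lact M d x0" if e: "e \<in> qexps n" for e
  proof -
    have "ideal_aut (\<rho> (Poly_Mapping.single e 1)) (\<rho> (Poly_Mapping.single (- e) (q powi (- qsig e e))))"
      using e by (intro aut qmult_monomial_inverse q_nonzero QT_single qexps_uminus)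
    then obtain V where V: "V \<in> QT n" "\<rho> (Poly_Mapping.single e 1) f = qmult q V f" using f(3) by blast
    then have "\<iota> (ract M x0 (Poly_Mapping.single e 1)) = \<iota> (lact M V x0)"
      using x0 by (simp add: \<rho> \<iota>_lact)
    then have "ract M x0 (Poly_Mapping.single e 1) = lact M V x0"
      using \<iota>_inj x0(1) V(1) e by (auto simp: QT_single dest: inj_onD)
    with V show ?thesis by blast
  qed
  have "\<exists>d\<in>QT n. ract M x0 a = lact M d x0" if a: "a \<in> QT n" for a
  proof -
    have "a \<in> QT n \<and> (\<exists>d\<in>QT n. ract M x0 a = lact M d x0)"
    proof (induction a rule: qelem_induct)
      case zero
      have "ract M x0 0 = lact M 0 x0" using x0 by simp
      then show ?case using QT_zero by blast
    next
      case (single e c)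
      then have e: "e \<in> qexps n" using a by (auto simp: QT_iff)
      then obtain d where d: "d \<in> QT n" "ract M x0 (Poly_Mapping.single e 1) = lact M d x0" using monomial by blast
      have "Poly_Mapping.single e c = qmult q (qscalar c) (Poly_Mapping.single e 1)"
        by (simp add: qscalar_def qmult_single_single)
      then have "ract M x0 (Poly_Mapping.single e c) = ract M (lact M (qscalar c) x0) (Poly_Mapping.single e 1)"
        using x0 e by (simp add: M.ract_qmult QT_single M.scalar_central)
      also have "\<dots> = lact M (qmult q (qscalar c) d) x0"
        using x0 e d by (simp add: M.ract_lact QT_single M.lact_qmult)
      finally show ?case using e d by (auto intro!: QT_single QT_qmult)
    next
      case (add g h)
      then obtain d d' where d: "d \<in> QT n" "d' \<in> QT n" "ract M x0 g = lact M d x0" "ract M x0 h = lact M d' x0" by blast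
      have "ract M x0 (g + h) = lact M (d + d') x0"
        using d add x0 by (simp add: M.ract_add_right M.lact_add_left)
      then show ?case using d add by (auto intro: QT_add)
    qed
    then show ?thesis by blast
  qed
  then show thesis using that x0(1) \<open>x0 \<noteq> zerob M\<close> by blast
qed

text \<open>The sums of values \<beta>(w,y) with w in W form a nonzero two-sided ideal J, hence all
  of the algebra. So \<beta>(z,y) is a signed sum of such \<beta>(w,y'), and middle linearity of x
  \<beta>'(y,z') turns z \<beta>'(y,z') into the corresponding sum of elements w \<beta>'(y',z') of
  W. The values of \<beta>' span 1, so z itself lies in W.\<close>

lemma subbimodule_eq:
  assumes W: "W \<subseteq> carr M" "zerob M \<in> W" "\<And>x y. x \<in> W \<Longrightarrow> y \<in> W \<Longrightarrow> addb M x y \<in> W"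
      "\<And>x. x \<in> W \<Longrightarrow> negb M x \<in> W"
      "\<And>a x. a \<in> QT n \<Longrightarrow> x \<in> W \<Longrightarrow> lact M a x \<in> W" "\<And>a x. a \<in> QT n \<Longrightarrow> x \<in> W \<Longrightarrow> ract M x a \<in> W"
    and nontrivial: "x0 \<in> W" "x0 \<noteq> zerob M"
  shows "W = carr M"
proof -
  let ?ev = "word_eval (twisted q n id) \<beta>"
  define J where "J = {?ev w | w. word_over W (carr N) w}"
  have over: "word_over (carr M) (carr N) w" if "word_over W (carr N) w" for w
    using that W(1) by (fastforce simp: word_over_def)
  have J_QT: "J \<subseteq> QT n" using over word_eval_\<beta>_closed by (auto simp: J_def)
  have \<beta>_in_J: "\<beta> w y \<in> J" if "w \<in> W" "y \<in> carr N" for w y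
    unfolding J_def using that by (intro CollectI exI[of _ "[((w, y), True)]"]) simp
  have J_add: "a + b \<in> J" if "a \<in> J" "b \<in> J" for a b
  proof -
    obtain u v where uv: "word_over W (carr N) u" "word_over W (carr N) v" "a = ?ev u" "b = ?ev v"
      using \<open>a \<in> J\<close> \<open>b \<in> J\<close> unfolding J_def by blast
    then have "?ev (u @ v) = a + b"
      using A.word_eval_append[of "carr M" "carr N" \<beta> u v] over by simp
    then show ?thesis using uv unfolding J_def by (metis (mono_tags, lifting) CollectI word_over_simps(3))
  qed
  \<comment> \<open>Negation, left and right multiplication on J are all additive maps f that act on
    a value of \<beta> by changing its arguments through maps g and h.\<close>
  have hom: "f a \<in> J"
    if a: "a \<in> J" and f: "\<And>a. a \<in> QT n \<Longrightarrow> f a \<in> QT n" "\<And>a b. a \<in> QT n \<Longrightarrow> b \<in> QT n \<Longrightarrow> f (a + b) = f a + f b"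
      and gh: "\<And>x y. x \<in> carr M \<Longrightarrow> y \<in> carr N \<Longrightarrow> f (\<beta> x y) = \<beta> (g x) (h y)"
        "\<And>x. x \<in> W \<Longrightarrow> g x \<in> W" "\<And>y. y \<in> carr N \<Longrightarrow> h y \<in> carr N" for f g h a
  proof -
    obtain u where u: "word_over W (carr N) u" "a = ?ev u" using a by (auto simp: J_def)
    have "f a = word_eval (twisted q n id) (\<lambda>x y. f (\<beta> x y)) u"
      unfolding u(2) by (rule word_eval_hom[OF A.bimod A.bimod _ _ _ over[OF u(1)]]) (auto simp: f)
    also have "\<dots> = word_eval (twisted q n id) (\<lambda>x y. \<beta> (g x) (h y)) u"
      by (rule word_eval_cong[OF over[OF u(1)] gh(1)])
    also have "\<dots> = ?ev (map (\<lambda>((x, y), s). ((g x, h y), s)) u)" by (simp add: word_eval_map)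
    finally show ?thesis unfolding J_def using word_over_map[where g = g and h = h, OF u(1) gh(2,3)] by blast
  qed
  have J_uminus: "- a \<in> J" if "a \<in> J" for a
    by (rule hom[of a uminus "negb M" "\<lambda>y. y"]) (use that W in \<open>auto simp: QT_uminus \<beta>_neg_left\<close>)
  have J_left: "qmult q b a \<in> J" if "b \<in> QT n" "a \<in> J" for a b
    by (rule hom[of a "qmult q b" "lact M b" "\<lambda>y. y"]) (use that W in \<open>auto simp: QT_qmult qmult_add_right \<beta>_lact\<close>)
  have J_right: "qmult q a b \<in> J" if "b \<in> QT n" "a \<in> J" for a b
    by (rule hom[of a "\<lambda>a. qmult q a b" "\<lambda>x. x" "\<lambda>y. ract N y b"]) (use that W in \<open>auto simp: QT_qmult qmult_add_left \<beta>_ract\<close>)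
  obtain y where y: "y \<in> carr N" "\<beta> x0 y \<noteq> 0"
    using \<beta>_nondegenerate_left[of x0] nontrivial W(1) by blast
  have "QT n \<subseteq> J"
  proof (rule QT_simple[OF q_nonzero not_root J_QT])
    show "\<beta> x0 y \<in> J" "\<beta> x0 y \<noteq> 0" using \<beta>_in_J y nontrivial by auto
    show "a - b \<in> J" if "a \<in> J" "b \<in> J" for a b using J_add[OF that(1) J_uminus[OF that(2)]] by simp
  qed (use J_left J_right in auto)
  have "z \<in> W" if z: "z \<in> carr M" for z
  proof -
    have "ract M z (\<beta>' y z') \<in> W" if y: "y \<in> carr N" and z': "z' \<in> carr M" for y z'
    proof -
      obtain v where v: "word_over W (carr N) v" "\<beta> z y = ?ev v"
        using \<open>QT n \<subseteq> J\<close> \<beta>_closed[OF z y] by (auto simp: J_def)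
      have "middle_linear n M N M (\<lambda>x y. ract M x (\<beta>' y z'))"
        using z' by (simp add: middle_linear_def M.ract_add_left M.ract_add_right sym.\<beta>_add_left
            sym.\<beta>_lact M.ract_qmult)
      from middle_linear_factors[OF bimod_M this z y over[OF v(1)] v(2)]
      have "ract M z (\<beta>' y z') = word_eval M (\<lambda>x y. ract M x (\<beta>' y z')) v" .
      also have "\<dots> \<in> W" using W z' by (intro word_eval_in[OF _ _ _ _ v(1)]) auto
      finally show ?thesis .
    qed
    then have "QT n \<subseteq> {a \<in> QT n. ract M z a \<in> W}"
      using z W by (intro sym.span) (auto simp: M.ract_add_right M.ract_uminus QT_add QT_uminus)
    then have "ract M z qone \<in> W" using QT_qscalar by blast
    then show ?thesis using z by simp
  qed
  then show ?thesis using W(1) by blast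
qed

text \<open>As \<beta>'(y, E x) is middle linear in y and x, it depends left linearly on
  \<beta>'(y,x), so it equals \<beta>'(y,x) c = \<beta>'(y, x c), where c is the value that belongs
  to 1. Nondegeneracy then removes y.\<close>

lemma left_endomorphism_is_right_action:
  assumes E: "\<And>x. x \<in> carr M \<Longrightarrow> E x \<in> carr M"
      "\<And>x y. x \<in> carr M \<Longrightarrow> y \<in> carr M \<Longrightarrow> E (addb M x y) = addb M (E x) (E y)"
      "\<And>a x. a \<in> QT n \<Longrightarrow> x \<in> carr M \<Longrightarrow> E (lact M a x) = lact M a (E x)"
  obtains c where "c \<in> QT n" "\<And>x. x \<in> carr M \<Longrightarrow> E x = ract M x c"
proof -
  define \<gamma> where "\<gamma> y x = \<beta>' y (E x)" for y x
  have \<gamma>: "middle_linear n N M (twisted q n id) \<gamma>"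
    by (simp add: middle_linear_def \<gamma>_def E sym.\<beta>_add_left sym.\<beta>_add_right sym.\<beta>_middle)
  obtain v where v: "word_over (carr N) (carr M) v" "word_eval (twisted q n id) \<beta>' v = qone"
    using sym.\<beta>_surj[OF QT_qscalar] .
  define c where "c = word_eval (twisted q n id) \<gamma> v"
  have c: "c \<in> QT n"
    unfolding c_def using A.word_eval_closed[of "carr N" "carr M" \<gamma> v] v \<gamma> by (simp add: middle_linear_def)
  have "E x = ract M x c" if x: "x \<in> carr M" for x
  proof -
    have *: "\<beta>' y (E x) = \<beta>' y (ract M x c)" if y: "y \<in> carr N" for y
    proof -
      define a where "a = \<beta>' y x"
      have a: "a \<in> QT n" using x y by (simp add: a_def)
      \<comment> \<open>The word v represents 1; multiplying its left entries by a represents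
        a.\<close>
      define v' where "v' = map (\<lambda>((y, x), s). ((lact N a y, x), s)) v"
      have v': "word_over (carr N) (carr M) v'"
        unfolding v'_def by (rule word_over_map[OF v(1), where h = "\<lambda>x. x", simplified]) (use a in auto)
      have scale: "word_eval (twisted q n id) \<delta> v' = qmult q a (word_eval (twisted q n id) \<delta> v)"
        if \<delta>: "\<And>y x. y \<in> carr N \<Longrightarrow> x \<in> carr M \<Longrightarrow> \<delta> y x \<in> QT n \<and> \<delta> (lact N a y) x = qmult q a (\<delta> y x)" for \<delta>
      proof -
        have "qmult q a (word_eval (twisted q n id) \<delta> v) = word_eval (twisted q n id) (\<lambda>y x. qmult q a (\<delta> y x)) v"
          by (rule word_eval_hom[OF A.bimod A.bimod _ _ _ v(1)]) (use a \<delta> in \<open>auto simp: QT_qmult qmult_add_right\<close>)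
        also have "\<dots> = word_eval (twisted q n id) (\<lambda>y x. \<delta> (lact N a y) x) v"
          by (rule word_eval_cong[OF v(1)]) (use \<delta> in simp)
        also have "\<dots> = word_eval (twisted q n id) \<delta> v'"
          unfolding v'_def by (rule word_eval_map[symmetric, where h = "\<lambda>x. x", simplified])
        finally show ?thesis ..
      qed
      have "word_eval (twisted q n id) \<beta>' v' = a" using scale[of \<beta>'] a v by (simp add: sym.\<beta>_lact)
      then have "\<beta>' y x = word_eval (twisted q n id) \<beta>' v'" by (simp add: a_def)
      from sym.middle_linear_factors[OF A.bimod \<gamma> y x v' this]
      have "\<beta>' y (E x) = word_eval (twisted q n id) \<gamma> v'" by (simp add: \<gamma>_def)
      also have "\<dots> = qmult q a c"
        unfolding c_def by (rule scale) (use a E in \<open>simp add: \<gamma>_def sym.\<beta>_lact\<close>)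
      finally show ?thesis using x y c by (simp add: a_def sym.\<beta>_ract)
    qed
    have "\<beta>' y (addb M (negb M (E x)) (ract M x c)) = 0" if "y \<in> carr N" for y
      using *[OF that] that x c E by (simp add: sym.\<beta>_add_right sym.\<beta>_neg_right)
    then have "addb M (negb M (E x)) (ract M x c) = zerob M"
      using x c E by (intro sym.\<beta>_nondegenerate_right) auto
    then show ?thesis by (rule M.eq_if_neg_add_zero[rotated 2]) (use x c E in auto)
  qed
  then show thesis using that c by blast
qed

theorem bimod_iso_twisted: "\<exists>\<psi>. qaut q n \<psi> \<and> bimod_iso q n M (twisted q n \<psi>)"
proof -
  obtain x0 where x0: "x0 \<in> carr M" "x0 \<noteq> zerob M"
    and eig: "\<And>a. a \<in> QT n \<Longrightarrow> \<exists>d\<in>QT n. ract M x0 a = lact M d x0"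
    by (rule eigenvector) (rule that)
  \<comment> \<open>The eigenvalue of x0 under right multiplication by a; it is unique because M has
    no left torsion.\<close>
  define \<psi> where "\<psi> a = (SOME d. d \<in> QT n \<and> ract M x0 a = lact M d x0)" for a
  have \<psi>: "\<psi> a \<in> QT n \<and> ract M x0 a = lact M (\<psi> a) x0" if "a \<in> QT n" for a
    unfolding \<psi>_def by (rule someI_ex) (use eig[OF that] in blast)
  have \<psi>_eqI: "\<psi> a = d" if "a \<in> QT n" "d \<in> QT n" "ract M x0 a = lact M d x0" for a d
    using \<psi>[OF that(1)] that x0 lact_cancel by metis
  define \<phi> where "\<phi> a = lact M a x0" for a
  have "\<phi> ` QT n = carr M"
  proof (rule subbimodule_eq)
    show "\<phi> ` QT n \<subseteq> carr M" using x0 by (auto simp: \<phi>_def)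
    show "zerob M \<in> \<phi> ` QT n" using x0 by (intro image_eqI[of _ _ 0]) (auto simp: \<phi>_def)
    show "x0 \<in> \<phi> ` QT n" using x0 by (intro image_eqI[of _ _ qone]) (auto simp: \<phi>_def)
    show "addb M x y \<in> \<phi> ` QT n" if "x \<in> \<phi> ` QT n" "y \<in> \<phi> ` QT n" for x y
    proof -
      obtain a b where "a \<in> QT n" "b \<in> QT n" "x = \<phi> a" "y = \<phi> b" using \<open>x \<in> \<phi> ` QT n\<close> \<open>y \<in> \<phi> ` QT n\<close> by blast
      then show ?thesis using x0 by (intro image_eqI[of _ _ "a + b"]) (auto simp: \<phi>_def M.lact_add_left QT_add)
    qed
    show "negb M x \<in> \<phi> ` QT n" if "x \<in> \<phi> ` QT n" for x
    proof -
      obtain a where "a \<in> QT n" "x = \<phi> a" using \<open>x \<in> \<phi> ` QT n\<close> by blast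
      then show ?thesis using x0 by (intro image_eqI[of _ _ "- a"]) (auto simp: \<phi>_def M.lact_uminus QT_uminus)
    qed
    show "lact M b x \<in> \<phi> ` QT n" if "b \<in> QT n" "x \<in> \<phi> ` QT n" for b x
    proof -
      obtain a where "a \<in> QT n" "x = \<phi> a" using \<open>x \<in> \<phi> ` QT n\<close> by blast
      then show ?thesis using x0 \<open>b \<in> QT n\<close>
        by (intro image_eqI[of _ _ "qmult q b a"]) (auto simp: \<phi>_def M.lact_qmult QT_qmult)
    qed
    \<comment> \<open>Here the eigenvector property is used: (a x0) b = a \<psi>(b) x0, so the left
      submodule generated by x0 is a subbimodule.\<close>
    show "ract M x b \<in> \<phi> ` QT n" if "b \<in> QT n" "x \<in> \<phi> ` QT n" for b x
    proof -
      obtain a where "a \<in> QT n" "x = \<phi> a" using \<open>x \<in> \<phi> ` QT n\<close> by blast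
      then show ?thesis using x0 \<open>b \<in> QT n\<close> \<psi>
        by (intro image_eqI[of _ _ "qmult q a (\<psi> b)"]) (auto simp: \<phi>_def M.lact_qmult QT_qmult M.ract_lact)
    qed
  qed (use x0 in auto)
  moreover have "inj_on \<phi> (QT n)"
    using x0 lact_cancel by (intro inj_onI) (auto simp: \<phi>_def)
  ultimately have \<phi>_bij: "bij_betw \<phi> (QT n) (carr M)" by (simp add: bij_betw_def)
  have \<phi>_add: "\<phi> (a + b) = addb M (\<phi> a) (\<phi> b)" if "a \<in> QT n" "b \<in> QT n" for a b
    using that x0 by (simp add: \<phi>_def M.lact_add_left)
  have \<phi>_lact: "\<phi> (qmult q b a) = lact M b (\<phi> a)" if "a \<in> QT n" "b \<in> QT n" for a b
    using that x0 by (simp add: \<phi>_def M.lact_qmult)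
  have \<phi>_ract: "\<phi> (qmult q a (\<psi> b)) = ract M (\<phi> a) b" if "a \<in> QT n" "b \<in> QT n" for a b
    using that x0 \<psi> by (simp add: \<phi>_def M.lact_qmult M.ract_lact)
  define f where "f = inv_into (QT n) \<phi>"
  have f_bij: "bij_betw f (carr M) (QT n)" unfolding f_def by (rule bij_betw_inv_into[OF \<phi>_bij])
  have f_\<phi>: "f (\<phi> a) = a" if "a \<in> QT n" for a
    using that \<phi>_bij by (simp add: f_def bij_betw_inv_into_left)
  have \<phi>_ex: "\<exists>a\<in>QT n. x = \<phi> a" if "x \<in> carr M" for x
    using that \<phi>_bij by (auto simp: bij_betw_def)
  have iso: "bimod_iso q n M (twisted q n \<psi>)"
    unfolding bimod_iso_def
  proof (intro exI[of _ f] conjI ballI)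
    show "bij_betw f (carr M) (carr (twisted q n \<psi>))" using f_bij by simp
    show "f (addb M x y) = addb (twisted q n \<psi>) (f x) (f y)" if xy: "x \<in> carr M" "y \<in> carr M" for x y
      using \<phi>_ex[OF xy(1)] \<phi>_ex[OF xy(2)] by (auto simp: f_\<phi> \<phi>_add[symmetric] QT_add)
    show "f (lact M a x) = lact (twisted q n \<psi>) a (f x)" if "a \<in> QT n" "x \<in> carr M" for a x
      using \<phi>_ex[OF that(2)] that(1) by (auto simp: f_\<phi> \<phi>_lact[symmetric] QT_qmult)
    show "f (ract M x a) = ract (twisted q n \<psi>) (f x) a" if "a \<in> QT n" "x \<in> carr M" for a x
    proof -
      obtain b where b: "b \<in> QT n" "x = \<phi> b" using \<phi>_ex[OF \<open>x \<in> carr M\<close>] by blast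
      have "f (ract M x a) = f (\<phi> (qmult q b (\<psi> a)))"
        unfolding b(2) by (rule arg_cong[OF \<phi>_ract[OF b(1) that(1), symmetric]])
      also have "\<dots> = qmult q b (\<psi> a)" using b(1) \<psi>[OF that(1)] by (intro f_\<phi> QT_qmult) auto
      finally show ?thesis using f_\<phi>[OF b(1)] b(2) by simp
    qed
  qed
  \<comment> \<open>Right multiplication by e on the algebra, carried over to M, is a left
    endomorphism and therefore the right action of some c; evaluated at x0 this says x0 c = e
    x0.\<close>
  have surj: "\<exists>c\<in>QT n. \<psi> c = e" if e: "e \<in> QT n" for e
  proof -
    define E where "E x = \<phi> (qmult q (f x) e)" for x
    have E_\<phi>: "E (\<phi> a) = \<phi> (qmult q a e)" if "a \<in> QT n" for a using that by (simp add: E_def f_\<phi>)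
    have \<phi>_closed: "\<phi> a \<in> carr M" if "a \<in> QT n" for a using that x0 by (simp add: \<phi>_def)
    obtain c where c: "c \<in> QT n" "\<And>x. x \<in> carr M \<Longrightarrow> E x = ract M x c"
    proof (rule left_endomorphism_is_right_action[of E])
      show "E x \<in> carr M" if "x \<in> carr M" for x
        using \<phi>_ex[OF that] e by (auto simp: E_\<phi> \<phi>_closed QT_qmult)
      show "E (addb M x y) = addb M (E x) (E y)" if xy: "x \<in> carr M" "y \<in> carr M" for x y
        using \<phi>_ex[OF xy(1)] \<phi>_ex[OF xy(2)] e
        by (auto simp: E_\<phi> \<phi>_add[symmetric] QT_add QT_qmult qmult_add_left)
      show "E (lact M a x) = lact M a (E x)" if "a \<in> QT n" "x \<in> carr M" for a x
        using \<phi>_ex[OF that(2)] that(1) e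
        by (auto simp: E_\<phi> \<phi>_lact[symmetric] QT_qmult qmult_assoc[OF q_nonzero])
    qed (rule that)
    have "ract M x0 c = E (\<phi> qone)" using c x0 by (simp add: \<phi>_def)
    also have "\<dots> = lact M e x0" by (simp add: E_\<phi>) (simp add: \<phi>_def)
    finally have "\<psi> c = e" using c e by (intro \<psi>_eqI)
    then show ?thesis using c by blast
  qed
  have "qaut q n \<psi>"
    unfolding qaut_def
  proof (intro conjI ballI allI)
    have "inj_on \<psi> (QT n)"
      using \<psi> ract_cancel[OF x0] by (intro inj_onI) metis
    moreover have "\<psi> ` QT n = QT n" using \<psi> surj by (auto simp: image_iff)
    ultimately show "bij_betw \<psi> (QT n) (QT n)" by (simp add: bij_betw_def)
    show "\<psi> (a + b) = \<psi> a + \<psi> b" if "a \<in> QT n" "b \<in> QT n" for a b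
      using that \<psi> x0 by (intro \<psi>_eqI) (auto simp: QT_add M.ract_add_right M.lact_add_left)
    show mult: "\<psi> (qmult q a b) = qmult q (\<psi> a) (\<psi> b)" if "a \<in> QT n" "b \<in> QT n" for a b
      using that \<psi> x0 by (intro \<psi>_eqI) (auto simp: QT_qmult M.ract_qmult M.lact_qmult M.ract_lact)
    have scalar: "\<psi> (qscalar c) = qscalar c" for c
      using x0 by (intro \<psi>_eqI) (auto simp: M.scalar_central)
    then show "\<psi> qone = qone" .
    show "\<psi> (qmult q (qscalar c) a) = qmult q (qscalar c) (\<psi> a)" if "a \<in> QT n" for c a
      using mult[OF QT_qscalar that] by (simp add: scalar)
  qed
  with iso show ?thesis by blast
qed

end

section \<open>Twisted bimodules\<close>

text \<open>Right multiplication of y by b is y \<phi>(b), which \<psi> turns into \<psi>(y)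
  \<psi>(\<phi>(b)); this is why the composite twist appears.\<close>

lemma tensor_map_twisted:
  assumes q: "q \<noteq> 0" and \<psi>: "qaut q n \<psi>" and \<phi>: "qaut q n \<phi>"
  shows "tensor_map q n (twisted q n \<psi>) (twisted q n \<phi>) (twisted q n (\<psi> \<circ> \<phi>)) (\<lambda>x y. qmult q x (\<psi> y))"
proof -
  let ?R = "tensor_rel n (twisted q n \<psi>) (twisted q n \<phi>)"
  let ?G = "tensor_gens n (twisted q n \<psi>) (twisted q n \<phi>)"
  let ?ev = "word_eval (twisted q n (\<psi> \<circ> \<phi>)) (\<lambda>x y. qmult q x (\<psi> y))"
  have \<psi>_hom: "\<psi> (a + b) = \<psi> a + \<psi> b" "\<psi> (qmult q a b) = qmult q (\<psi> a) (\<psi> b)"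
    if "a \<in> QT n" "b \<in> QT n" for a b
    using \<psi> that by (auto simp: qaut_def)
  have \<psi>_one: "\<psi> qone = qone" using \<psi> by (simp add: qaut_def)
  note closed = qaut_closed[OF \<psi>] qaut_closed[OF \<phi>] QT_qmult QT_add QT_uminus
  have balanced: "balanced_bimap q n (twisted q n \<psi>) (twisted q n \<phi>) (twisted q n (\<psi> \<circ> \<phi>)) (\<lambda>x y. qmult q x (\<psi> y))"
    by (simp add: balanced_bimap_def closed \<psi>_hom qmult_add_left qmult_add_right qmult_assoc[OF q])
  have surj: "\<exists>w. word_over (QT n) (QT n) w \<and> ?ev w = a" if "a \<in> QT n" for a
    using that by (intro exI[of _ "[((a, qone), True)]"]) (simp add: \<psi>_one)
  have gen_add: "delta (x + x', qone) - delta (x, qone) - delta (x', qone) \<in> ?G" if "x \<in> QT n" "x' \<in> QT n" for x x'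
    unfolding tensor_gens_def
    by (rule UnI1, rule UnI1, rule CollectI, rule exI[of _ x], rule exI[of _ x'], rule exI[of _ qone])
      (use that in simp)
  have gen_mid: "delta (qmult q x (\<psi> y), qone) - delta (x, y) \<in> ?G" if "x \<in> QT n" "y \<in> QT n" for x y
    unfolding tensor_gens_def
    by (rule UnI2, rule CollectI, rule exI[of _ x], rule exI[of _ y], rule exI[of _ qone])
      (use that in simp)
  have ev_closed: "?ev w \<in> QT n" if "word_over (QT n) (QT n) w" for w
    by (rule word_eval_in[OF _ _ _ _ that]) (auto simp: closed)
  text \<open>In the tensor product, \<open>x \<otimes> y = x \<psi>(y) \<otimes> 1\<close>, so that each word is equivalent to a pure tensor.\<close>
  have reduce: "content w - delta (?ev w, qone) \<in> ?R" if "word_over (QT n) (QT n) w" for w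
    using that
  proof (induction w)
    case Nil
    \<comment> \<open>The empty word has content 0, but 0 \<otimes> 1 is still to be identified with
      0; the generator for 0 + 0 does this.\<close>
    have "0 + (delta (0 + 0, qone) - delta (0, qone) - delta (0, qone)) \<in> ?R"
      by (rule tensor_rel.add[OF tensor_rel.zero gen_add]) auto
    then show ?case by (simp add: fun_Compl_def)
  next
    case (Cons p w)
    obtain x y s where p: "p = ((x, y), s)" by (metis prod.exhaust)
    have xy: "x \<in> QT n" "y \<in> QT n" and w: "word_over (QT n) (QT n) w" using Cons.prems p by auto
    define u where "u = qmult q x (\<psi> y)"
    have u: "u \<in> QT n" unfolding u_def using xy closed by simp
    have e: "?ev w \<in> QT n" by (rule ev_closed[OF w])
    have IH: "content w - delta (?ev w, qone) \<in> ?R" by (rule Cons.IH[OF w])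
    have mid: "delta (u, qone) - delta (x, y) \<in> ?G" unfolding u_def by (rule gen_mid[OF xy])
    show ?case
    proof (cases s)
      case True
      have rearr: "d1 + c - d2 = ((c - d3) - (d4 - d1)) - (d2 - d4 - d3)"
        for c d1 d2 d3 d4 :: "qelem \<times> qelem \<Rightarrow> int" by (simp add: algebra_simps)
      have "content (p # w) - delta (?ev (p # w), qone)
        = delta (x, y) + content w - delta (u + ?ev w, qone)"
        by (simp add: p True u_def)
      also have "\<dots> \<in> ?R"
        unfolding rearr[where c = "content w" and ?d3.0 = "delta (?ev w, qone)" and ?d4.0 = "delta (u, qone)"]
        by (rule tensor_rel.sub[OF tensor_rel.sub[OF IH mid] gen_add[OF u e]])
      finally show ?thesis .
    next
      case False
      have rearr: "- d1 + c - d2 = ((c - d3) + (d4 - d1)) + (d3 - d4 - d2)"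
        for c d1 d2 d3 d4 :: "qelem \<times> qelem \<Rightarrow> int" by (simp add: algebra_simps)
      \<comment> \<open>A negative letter is absorbed by splitting the value of w as u + (- u +
        value), instead of relating - u to the negative of u separately.\<close>
      have "delta (u + (- u + ?ev w), qone) - delta (u, qone) - delta (- u + ?ev w, qone) \<in> ?G"
        by (rule gen_add[OF u QT_add[OF QT_uminus[OF u] e]])
      then have g: "delta (?ev w, qone) - delta (u, qone) - delta (- u + ?ev w, qone) \<in> ?G" by simp
      have "content (p # w) - delta (?ev (p # w), qone)
        = - delta (x, y) + content w - delta (- u + ?ev w, qone)"
        by (simp add: p False u_def)
      also have "\<dots> \<in> ?R"
        unfolding rearr[where c = "content w" and ?d3.0 = "delta (?ev w, qone)" and ?d4.0 = "delta (u, qone)"]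
        by (rule tensor_rel.add[OF tensor_rel.add[OF IH mid] g])
      finally show ?thesis .
    qed
  qed
  have "content w \<in> ?R" if w: "word_over (QT n) (QT n) w" and zero: "?ev w = 0" for w
  proof -
    have "content w - delta (0, qone) \<in> ?R" using reduce[OF w] unfolding zero .
    from tensor_rel.sub[OF this gen_add[of 0 0]]
    show ?thesis by simp
  qed
  then show ?thesis unfolding tensor_map_def using balanced surj by simp
qed

text \<open>A left linear bijection of the algebra is right multiplication by u = f(1), and
  compatibility with the right actions becomes \<psi>(a) u = u \<phi>(a).\<close>

lemma bimod_iso_twisted_imp_inner:
  assumes q: "q \<noteq> 0" and \<psi>: "qaut q n \<psi>" and \<phi>: "qaut q n \<phi>"
    and iso: "bimod_iso q n (twisted q n \<psi>) (twisted q n \<phi>)"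
  shows "qinner q n (\<psi> \<circ> inv_into (QT n) \<phi>)"
proof -
  obtain f where f: "bij_betw f (QT n) (QT n)"
    and lact: "\<And>a x. a \<in> QT n \<Longrightarrow> x \<in> QT n \<Longrightarrow> f (qmult q a x) = qmult q a (f x)"
    and ract: "\<And>a x. a \<in> QT n \<Longrightarrow> x \<in> QT n \<Longrightarrow> f (qmult q x (\<psi> a)) = qmult q (f x) (\<phi> a)"
    using iso by (auto simp: bimod_iso_def)
  define u where "u = f qone"
  have u: "u \<in> QT n" using f by (auto simp: u_def bij_betw_def)
  have f_eq: "f x = qmult q x u" if "x \<in> QT n" for x
    using lact[OF that QT_qscalar[of 1]] by (simp add: u_def)
  have "qone \<in> f ` QT n" using f QT_qscalar by (auto simp: bij_betw_def)
  then obtain v where v: "v \<in> QT n" "f v = qone" by auto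
  then have vu: "qmult q v u = qone" by (simp add: f_eq)
  \<comment> \<open>So far v is only a left inverse of u; injectivity of f makes it
    two-sided.\<close>
  have "f (qmult q u v) = f qone"
    using u v by (simp add: f_eq QT_qmult qmult_assoc[OF q] vu)
  then have uv: "qmult q u v = qone"
    using f u v by (auto simp: bij_betw_def QT_qmult dest: inj_onD)
  have "(\<psi> \<circ> inv_into (QT n) \<phi>) b = qmult q (qmult q u b) v" if b: "b \<in> QT n" for b
  proof -
    define a where "a = inv_into (QT n) \<phi> b"
    have a: "a \<in> QT n" "\<phi> a = b"
      using \<phi> b by (auto simp: a_def qaut_def bij_betw_def inv_into_into f_inv_into_f)
    have "qmult q (\<psi> a) u = qmult q u b"
      using ract[OF a(1) QT_qscalar[of 1]] f_eq[OF qaut_closed[OF \<psi> a(1)]] a(2) by (simp add: u_def)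
    then have "qmult q (qmult q u b) v = qmult q (qmult q (\<psi> a) u) v" by simp
    also have "\<dots> = \<psi> a" by (simp add: qmult_assoc[OF q] uv)
    finally show ?thesis by (simp add: a_def)
  qed
  with u v uv vu show ?thesis unfolding qinner_def by blast
qed

text \<open>The same relation \<psi>(a) u = u \<phi>(a), read backwards, says that right
  multiplication by the unit u intertwines the two right actions.\<close>

lemma inner_imp_bimod_iso_twisted:
  assumes q: "q \<noteq> 0" and \<psi>: "qaut q n \<psi>" and \<phi>: "qaut q n \<phi>"
    and inner: "qinner q n (\<psi> \<circ> inv_into (QT n) \<phi>)"
  shows "bimod_iso q n (twisted q n \<psi>) (twisted q n \<phi>)"
proof -
  obtain u v where u: "u \<in> QT n" and v: "v \<in> QT n" and uv: "qmult q u v = qone" and vu: "qmult q v u = qone"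
    and conj: "\<And>b. b \<in> QT n \<Longrightarrow> \<psi> (inv_into (QT n) \<phi> b) = qmult q (qmult q u b) v"
    using inner by (auto simp: qinner_def)
  have twist: "qmult q (\<psi> a) u = qmult q u (\<phi> a)" if a: "a \<in> QT n" for a
  proof -
    have "inv_into (QT n) \<phi> (\<phi> a) = a" using \<phi> a by (simp add: qaut_def bij_betw_def)
    then have "\<psi> a = qmult q (qmult q u (\<phi> a)) v" using conj[OF qaut_closed[OF \<phi> a]] by simp
    then show ?thesis by (simp add: qmult_assoc[OF q] vu)
  qed
  have "bij_betw (\<lambda>x. qmult q x u) (QT n) (QT n)"
    by (rule bij_betw_byWitness[where f' = "\<lambda>x. qmult q x v"])
      (use u v in \<open>auto simp: qmult_assoc[OF q] uv vu QT_qmult\<close>)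
  then show ?thesis
    unfolding bimod_iso_def
    by (intro exI[of _ "\<lambda>x. qmult q x u"]) (simp add: qmult_add_left qmult_assoc[OF q] twist)
qed

theorem theorem6p1:
  fixes q :: complex and n :: nat
  assumes "q \<noteq> 0" and "\<forall>k::nat. k > 0 \<longrightarrow> q ^ k \<noteq> 1" and "n \<ge> 1"
  shows
    \<comment> \<open>the map is a homomorphism: (A)_psi \<otimes> (A)_phi \<cong> (A)_(psi o phi)\<close>
    "(\<forall>\<psi> \<phi>. qaut q n \<psi> \<and> qaut q n \<phi> \<longrightarrow>
        tensor_iso q n (twisted q n \<psi>) (twisted q n \<phi>) (twisted q n (\<psi> \<circ> \<phi>))) \<and>
    \<comment> \<open>well defined and injective on Aut/Inn\<close>
     (\<forall>\<psi> \<phi>. qaut q n \<psi> \<and> qaut q n \<phi> \<longrightarrow>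
        (bimod_iso q n (twisted q n \<psi>) (twisted q n \<phi>)
           \<longleftrightarrow> qinner q n (\<psi> \<circ> inv_into (QT n) \<phi>))) \<and>
    \<comment> \<open>surjective onto Pic: every invertible bimodule is isomorphic to some (A)_psi\<close>
     (\<forall>(M :: 'm bimod) (N :: 'n bimod). invertible_bimod q n M N \<longrightarrow>
        (\<exists>\<psi>. qaut q n \<psi> \<and> bimod_iso q n M (twisted q n \<psi>)))"
proof (intro conjI allI impI)
  fix \<psi> \<phi> assume "qaut q n \<psi> \<and> qaut q n \<phi>"
  then show "tensor_iso q n (twisted q n \<psi>) (twisted q n \<phi>) (twisted q n (\<psi> \<circ> \<phi>))"
    using tensor_map_twisted assms(1) unfolding tensor_iso_iff by blast
next
  fix \<psi> \<phi> assume "qaut q n \<psi> \<and> qaut q n \<phi>"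
  then show "bimod_iso q n (twisted q n \<psi>) (twisted q n \<phi>) \<longleftrightarrow> qinner q n (\<psi> \<circ> inv_into (QT n) \<phi>)"
    using bimod_iso_twisted_imp_inner inner_imp_bimod_iso_twisted assms(1) by blast
next
  fix M :: "'m bimod" and N :: "'n bimod"
  assume "invertible_bimod q n M N"
  then obtain \<beta> \<beta>' where "morita q n M N \<beta> \<beta>'"
    unfolding invertible_bimod_def tensor_iso_iff morita_def using assms(1,2) by blast
  then show "\<exists>\<psi>. qaut q n \<psi> \<and> bimod_iso q n M (twisted q n \<psi>)"
    by (rule morita.bimod_iso_twisted)
qed

end
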